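(* Let $S$ and $T$ be Cu-semigroups, let $J$ be an ideal of $T$, and let $\iota\colon J\to T$ denote the inclusion map. Then the induced Cu-morphism $\iota_*\colon[\![S,J]\!]\to[\![S,T]\!]$ is an order-embedding that identifies $[\![S,J]\!]$ with an ideal of $[\![S,T]\!]$. Moreover, $x\in[\![S,T]\!]$ belongs to (the image of) $[\![S,J]\!]$ if and only if for some (equivalently, for every) path $(f_\lambda)_\lambda$ in $\mathrm{Cu}[S,T]$ representing $x$, each $f_\lambda$ takes image in $J$.
   Context: A positively ordered semigroup is a commutative monoid $(S,+,0)$ with a partial order $\le$ compatible with addition such that $0\le a$ for all $a$. For $a,b\in S$, $a\ll b$ (way-below) means: whenever $(c_n)_n$ is an increasing sequence in $S$ whose supremum exists and satisfies $b\le\sup_n c_n$, there is $k$ with $a\le c_k$. A Cu-semigroup is a positively ordered semigroup satisfying: (O1) every increasing sequence has a supremum; (O2) every $a$ is the supremum of a sequence $(a_n)_n$ with $a_n\ll a_{n+1}$ for all $n$; (O3) $a'\ll a$ and $b'\ll b$ imply $a'+b'\ll a+b$; (O4) $\sup_n(a_n+b_n)=\sup_n a_n+\sup_n b_n$ for increasing sequences. A generalized Cu-morphism is a map between Cu-semigroups preserving addition, zero, order and suprema of increasing sequences; a Cu-morphism additionally preserves $\ll$. $\mathrm{Cu}[S,T]$ denotes the set of generalized Cu-morphisms $S\to T$, with pointwise order and addition. A map $f$ is an order-embedding if $f(a)\le f(b)$ iff $a\le b$. An ideal of a Cu-semigroup $S$ is a submonoid $J\subseteq S$ that is closed under suprema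 of increasing sequences and downward-hereditary (if $a\le b$ and $b\in J$ then $a\in J$). An ideal, with the inherited order, is a Cu-semigroup and the inclusion is a Cu-morphism. Let $I_{\mathbb Q}=\mathbb Q\cap(0,1)$. For $\varphi,\psi\in\mathrm{Cu}[S,T]$ write $\varphi\prec\psi$ if $\varphi(a')\ll\psi(a)$ whenever $a'\ll a$ in $S$. A path in $\mathrm{Cu}[S,T]$ is a family $\mathbf f=(f_\lambda)_{\lambda\in I_{\mathbb Q}}$ with $f_{\lambda'}\prec f_\lambda$ whenever $\lambda'<\lambda$. Write $\mathbf f\lesssim\mathbf g$ if for every $\lambda$ there is $\mu$ with $f_\lambda\prec g_\mu$. The internal hom $[\![S,T]\!]$ is the set of classes $[\mathbf f]$ of paths modulo ($\mathbf f\lesssim\mathbf g$ and $\mathbf g\lesssim\mathbf f$), with $[\mathbf f]+[\mathbf g]=[(f_\lambda+g_\lambda)_\lambda]$ and $[\mathbf f]\le[\mathbf g]$ iff $\mathbf f\lesssim\mathbf g$; it is a Cu-semigroup. For a Cu-morphism $\iota\colon X\to Y$, $\iota_*\colon[\![S,X]\!]\to[\![S,Y]\!]$ is the Cu-morphism $[(f_\lambda)_\lambda]\mapsto[(\iota\circ f_\lambda)_\lambda]$. *)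

theory Defs
  imports "HOL-Algebra.Group" "HOL.Rat"
begin

text \<open>
  Semigroups are carrier-based, so that an ideal \<open>J\<close> of \<open>T\<close> is itself the structure
  \<open>T\<lparr>carrier := J\<rparr>\<close>. The monoid operation of the library record is written additively.
\<close>

record 'a ordered_monoid = "'a monoid" +
  leq :: "'a \<Rightarrow> 'a \<Rightarrow> bool" (infix "\<preceq>\<index>" 50)

notation mult (infixl "\<oplus>\<index>" 65)
notation one ("\<zero>\<index>")

locale pos_ordered_semigroup = comm_monoid S for S (structure) +
  assumes leq_refl: "a \<in> carrier S \<Longrightarrow> a \<preceq> a"
    and leq_antisym:
      "\<lbrakk>a \<in> carrier S; b \<in> carrier S; a \<preceq> b; b \<preceq> a\<rbrakk> \<Longrightarrow> a = b"
    and leq_trans: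
      "\<lbrakk>a \<in> carrier S; b \<in> carrier S; c \<in> carrier S; a \<preceq> b; b \<preceq> c\<rbrakk> \<Longrightarrow> a \<preceq> c"
    and add_mono:
      "\<lbrakk>a \<in> carrier S; b \<in> carrier S; c \<in> carrier S; a \<preceq> b\<rbrakk> \<Longrightarrow> a \<oplus> c \<preceq> b \<oplus> c"
    and zero_leq: "a \<in> carrier S \<Longrightarrow> \<zero> \<preceq> a"

definition increasing :: "('a, 'm) ordered_monoid_scheme \<Rightarrow> (nat \<Rightarrow> 'a) \<Rightarrow> bool" where
  "increasing S c \<longleftrightarrow> (\<forall>n. c n \<in> carrier S) \<and> (\<forall>n. c n \<preceq>\<^bsub>S\<^esub> c (Suc n))"

definition is_sup :: "('a, 'm) ordered_monoid_scheme \<Rightarrow> (nat \<Rightarrow> 'a) \<Rightarrow> 'a \<Rightarrow> bool" where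
  "is_sup S c s \<longleftrightarrow> s \<in> carrier S \<and> (\<forall>n. c n \<preceq>\<^bsub>S\<^esub> s) \<and>
     (\<forall>u \<in> carrier S. (\<forall>n. c n \<preceq>\<^bsub>S\<^esub> u) \<longrightarrow> s \<preceq>\<^bsub>S\<^esub> u)"

definition way_below :: "('a, 'm) ordered_monoid_scheme \<Rightarrow> 'a \<Rightarrow> 'a \<Rightarrow> bool"
    (infix "\<lless>\<index>" 50) where
  "a \<lless>\<^bsub>S\<^esub> b \<longleftrightarrow>
     (\<forall>c s. increasing S c \<and> is_sup S c s \<and> b \<preceq>\<^bsub>S\<^esub> s \<longrightarrow> (\<exists>k. a \<preceq>\<^bsub>S\<^esub> c k))"

locale cu_semigroup = pos_ordered_semigroup +
  assumes O1: "increasing S c \<Longrightarrow> \<exists>s. is_sup S c s"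
    and O2: "a \<in> carrier S \<Longrightarrow>
      \<exists>c. (\<forall>n. c n \<in> carrier S) \<and> (\<forall>n. c n \<lless> c (Suc n)) \<and> is_sup S c a"
    and O3: "\<lbrakk>a' \<in> carrier S; a \<in> carrier S; b' \<in> carrier S; b \<in> carrier S;
      a' \<lless> a; b' \<lless> b\<rbrakk> \<Longrightarrow> a' \<oplus> b' \<lless> a \<oplus> b"
    and O4: "\<lbrakk>increasing S c; increasing S d; is_sup S c s; is_sup S d t\<rbrakk> \<Longrightarrow>
      is_sup S (\<lambda>n. c n \<oplus> d n) (s \<oplus> t)"

text \<open>
  Morphisms are extensional functions, so that equality of elements of \<open>Cu[S,T]\<close> is
  equality of maps on the carrier of \<open>S\<close>.
\<close>

locale generalized_cu_morphism = S: cu_semigroup S + T: cu_semigroup T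
  for S :: "('a, 'm) ordered_monoid_scheme" and T :: "('b, 'n) ordered_monoid_scheme" +
  fixes f :: "'a \<Rightarrow> 'b"
  assumes maps: "f \<in> carrier S \<rightarrow>\<^sub>E carrier T"
    and map_add: "\<lbrakk>a \<in> carrier S; b \<in> carrier S\<rbrakk> \<Longrightarrow> f (a \<oplus>\<^bsub>S\<^esub> b) = f a \<oplus>\<^bsub>T\<^esub> f b"
    and map_zero: "f \<zero>\<^bsub>S\<^esub> = \<zero>\<^bsub>T\<^esub>"
    and map_leq: "\<lbrakk>a \<in> carrier S; b \<in> carrier S; a \<preceq>\<^bsub>S\<^esub> b\<rbrakk> \<Longrightarrow> f a \<preceq>\<^bsub>T\<^esub> f b"
    and map_sup: "\<lbrakk>increasing S c; is_sup S c s\<rbrakk> \<Longrightarrow> is_sup T (\<lambda>n. f (c n)) (f s)"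

locale cu_morphism = generalized_cu_morphism +
  assumes map_way_below:
    "\<lbrakk>a \<in> carrier S; b \<in> carrier S; a \<lless>\<^bsub>S\<^esub> b\<rbrakk> \<Longrightarrow> f a \<lless>\<^bsub>T\<^esub> f b"

definition Cu :: "('a, 'm) ordered_monoid_scheme \<Rightarrow> ('b, 'n) ordered_monoid_scheme \<Rightarrow>
    ('a \<Rightarrow> 'b) set" where
  "Cu S T = {f. generalized_cu_morphism S T f}"

definition order_embedding :: "('a, 'm) ordered_monoid_scheme \<Rightarrow>
    ('b, 'n) ordered_monoid_scheme \<Rightarrow> ('a \<Rightarrow> 'b) \<Rightarrow> bool" where
  "order_embedding S T f \<longleftrightarrow> f \<in> carrier S \<rightarrow> carrier T \<and>
     (\<forall>a \<in> carrier S. \<forall>b \<in> carrier S. f a \<preceq>\<^bsub>T\<^esub> f b \<longleftrightarrow> a \<preceq>\<^bsub>S\<^esub> b)"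

locale cu_ideal = cu_semigroup S + submonoid J S for J and S (structure) +
  assumes sup_closed: "\<lbrakk>increasing S c; \<And>n. c n \<in> J; is_sup S c s\<rbrakk> \<Longrightarrow> s \<in> J"
    and hereditary: "\<lbrakk>a \<in> carrier S; b \<in> J; a \<preceq> b\<rbrakk> \<Longrightarrow> a \<in> J"

definition I_Q :: "rat set" where
  "I_Q = {0<..<1}"

definition precedes :: "('a, 'm) ordered_monoid_scheme \<Rightarrow> ('b, 'n) ordered_monoid_scheme \<Rightarrow>
    ('a \<Rightarrow> 'b) \<Rightarrow> ('a \<Rightarrow> 'b) \<Rightarrow> bool" where
  "precedes S T \<phi> \<psi> \<longleftrightarrow>
     (\<forall>a' \<in> carrier S. \<forall>a \<in> carrier S. a' \<lless>\<^bsub>S\<^esub> a \<longrightarrow> \<phi> a' \<lless>\<^bsub>T\<^esub> \<psi> a)"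

definition cu_paths :: "('a, 'm) ordered_monoid_scheme \<Rightarrow> ('b, 'n) ordered_monoid_scheme \<Rightarrow>
    (rat \<Rightarrow> 'a \<Rightarrow> 'b) set" where
  "cu_paths S T = {f \<in> I_Q \<rightarrow>\<^sub>E Cu S T.
     \<forall>l' \<in> I_Q. \<forall>l \<in> I_Q. l' < l \<longrightarrow> precedes S T (f l') (f l)}"

definition path_lesssim :: "('a, 'm) ordered_monoid_scheme \<Rightarrow>
    ('b, 'n) ordered_monoid_scheme \<Rightarrow> (rat \<Rightarrow> 'a \<Rightarrow> 'b) \<Rightarrow> (rat \<Rightarrow> 'a \<Rightarrow> 'b) \<Rightarrow> bool" where
  "path_lesssim S T f g \<longleftrightarrow> (\<forall>l \<in> I_Q. \<exists>m \<in> I_Q. precedes S T (f l) (g m))"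

definition path_rel :: "('a, 'm) ordered_monoid_scheme \<Rightarrow> ('b, 'n) ordered_monoid_scheme \<Rightarrow>
    ((rat \<Rightarrow> 'a \<Rightarrow> 'b) \<times> (rat \<Rightarrow> 'a \<Rightarrow> 'b)) set" where
  "path_rel S T = {(f, g). f \<in> cu_paths S T \<and> g \<in> cu_paths S T \<and>
     path_lesssim S T f g \<and> path_lesssim S T g f}"

definition path_class :: "('a, 'm) ordered_monoid_scheme \<Rightarrow> ('b, 'n) ordered_monoid_scheme \<Rightarrow>
    (rat \<Rightarrow> 'a \<Rightarrow> 'b) \<Rightarrow> (rat \<Rightarrow> 'a \<Rightarrow> 'b) set" where
  "path_class S T f = path_rel S T `` {f}"

definition path_add :: "('a, 'm) ordered_monoid_scheme \<Rightarrow> ('b, 'n) ordered_monoid_scheme \<Rightarrow>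
    (rat \<Rightarrow> 'a \<Rightarrow> 'b) \<Rightarrow> (rat \<Rightarrow> 'a \<Rightarrow> 'b) \<Rightarrow> rat \<Rightarrow> 'a \<Rightarrow> 'b" where
  "path_add S T f g = (\<lambda>l \<in> I_Q. \<lambda>a \<in> carrier S. f l a \<oplus>\<^bsub>T\<^esub> g l a)"

text \<open>
  Operations on classes are given by representatives. They do not depend on the choice of
  representatives, so each union below is the union of one and the same class.
\<close>

definition internal_hom :: "('a, 'm) ordered_monoid_scheme \<Rightarrow>
    ('b, 'n) ordered_monoid_scheme \<Rightarrow> (rat \<Rightarrow> 'a \<Rightarrow> 'b) set ordered_monoid" where
  "internal_hom S T =
     \<lparr>carrier = cu_paths S T // path_rel S T,
      mult = (\<lambda>x y. \<Union>f \<in> x. \<Union>g \<in> y. path_class S T (path_add S T f g)),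
      one = path_class S T (\<lambda>l \<in> I_Q. \<lambda>a \<in> carrier S. \<zero>\<^bsub>T\<^esub>),
      leq = (\<lambda>x y. \<exists>f \<in> x. \<exists>g \<in> y. path_lesssim S T f g)\<rparr>"

definition internal_hom_map :: "('a, 'm) ordered_monoid_scheme \<Rightarrow>
    ('b, 'n) ordered_monoid_scheme \<Rightarrow> ('c, 'k) ordered_monoid_scheme \<Rightarrow> ('b \<Rightarrow> 'c) \<Rightarrow>
    (rat \<Rightarrow> 'a \<Rightarrow> 'b) set \<Rightarrow> (rat \<Rightarrow> 'a \<Rightarrow> 'c) set" where
  "internal_hom_map S X Y h = (\<lambda>x \<in> carrier (internal_hom S X).
     \<Union>f \<in> x. path_class S Y (\<lambda>l \<in> I_Q. compose (carrier S) h (f l)))"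

end

theory Submission
  imports Defs
begin

text \<open>
  The relation \<open>\<prec>\<close> on \<open>Cu[S,T]\<close> is transitive and additive, and this makes the classes of
  paths a Cu-semigroup: the supremum of an increasing sequence of paths is obtained by concatenating
  pieces of them, \<open>[f]\<close> is way below \<open>[g]\<close> iff a single \<open>g \<mu>\<close> dominates all \<open>f \<lambda>\<close>, and \<open>[f]\<close> is
  the supremum of its reparametrised cut-downs. Since \<open>\<phi> \<prec> \<psi>\<close> implies \<open>\<phi> \<le> \<psi>\<close> pointwise and \<open>J\<close> is
  hereditary, every path below a path with values in \<open>J\<close> takes values in \<open>J\<close>. The classes of a path
  in \<open>Cu[S,J]\<close> and of the same path in \<open>Cu[S,T]\<close> therefore coincide as sets, so that the induced
  map is literally an inclusion.
\<close>

section \<open>Order and way-below in positively ordered semigroups\<close>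

context pos_ordered_semigroup
begin

lemma is_sup_unique: "\<lbrakk>is_sup S c s; is_sup S c t\<rbrakk> \<Longrightarrow> s = t"
  unfolding is_sup_def using leq_antisym by blast

lemma is_sup_const: "a \<in> carrier S \<Longrightarrow> is_sup S (\<lambda>_. a) a"
  unfolding is_sup_def using leq_refl by blast

lemma way_below_imp_leq:
  assumes "b \<in> carrier S" and "a \<lless> b"
  shows "a \<preceq> b"
proof -
  have "increasing S (\<lambda>_. b)"
    using assms(1) leq_refl by (simp add: increasing_def)
  then show ?thesis
    using assms is_sup_const[of b] leq_refl[of b] by (auto simp: way_below_def)
qed

lemma leq_way_below_trans:
  assumes "a \<in> carrier S" "a' \<in> carrier S" "a \<preceq> a'" "a' \<lless> b"
  shows "a \<lless> b"
  unfolding way_below_def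
proof (intro allI impI, elim conjE)
  fix c s assume c: "increasing S c" "is_sup S c s" "b \<preceq> s"
  then obtain k where "a' \<preceq> c k" using assms(4) by (auto simp: way_below_def)
  moreover have "c k \<in> carrier S" using c by (simp add: increasing_def)
  ultimately have "a \<preceq> c k" using assms leq_trans[of a a' "c k"] by simp
  then show "\<exists>k. a \<preceq> c k" ..
qed

lemma way_below_leq_trans:
  assumes "b \<in> carrier S" "b' \<in> carrier S" "a \<lless> b" "b \<preceq> b'"
  shows "a \<lless> b'"
  unfolding way_below_def
proof (intro allI impI, elim conjE)
  fix c s assume c: "increasing S c" "is_sup S c s" "b' \<preceq> s"
  then have "s \<in> carrier S" by (simp add: is_sup_def)
  then have "b \<preceq> s" using c assms leq_trans[of b b' s] by simp
  then show "\<exists>k. a \<preceq> c k" using assms(3) c by (auto simp: way_below_def)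
qed

lemma zero_way_below: "\<zero> \<lless> b"
  by (auto simp: way_below_def increasing_def zero_leq)

lemma add_mono2:
  assumes "a \<in> carrier S" "b \<in> carrier S" "c \<in> carrier S" "d \<in> carrier S"
    and "a \<preceq> b" "c \<preceq> d"
  shows "a \<oplus> c \<preceq> b \<oplus> d"
proof -
  have "a \<oplus> c \<preceq> b \<oplus> c" using assms add_mono by simp
  moreover have "b \<oplus> c \<preceq> b \<oplus> d"
    using assms add_mono[of c d b] by (simp add: m_comm)
  ultimately show ?thesis using assms leq_trans[of "a \<oplus> c" "b \<oplus> c" "b \<oplus> d"] by simp
qed

end

text \<open>Axiom (O2) only provides \<open>c n \<lless> c (Suc n)\<close> and the supremum.
  Monotonicity follows because way-below implies the order, and \<open>c n \<lless> a\<close>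
  because \<open>c (Suc n)\<close> lies below the supremum \<open>a\<close>.\<close>

lemma (in cu_semigroup) way_below_sequenceE:
  assumes a: "a \<in> carrier S"
  obtains c where "increasing S c" "\<And>n. c n \<in> carrier S" "\<And>n. c n \<lless> c (Suc n)"
    "\<And>n. c n \<lless> a" "\<And>n. c n \<preceq> a" "is_sup S c a"
proof -
  obtain c where c: "\<And>n. c n \<in> carrier S" "\<And>n. c n \<lless> c (Suc n)" "is_sup S c a"
    using O2[OF a] by blast
  moreover have "increasing S c"
    using c(1) way_below_imp_leq[OF c(1) c(2)] by (simp add: increasing_def)
  moreover have leq: "c n \<preceq> a" for n using c(3) by (simp add: is_sup_def)
  moreover have "c n \<lless> a" for n by (rule way_below_leq_trans[OF c(1) a c(2) leq])
  ultimately show thesis by (intro that[of c])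
qed

section \<open>The parameter set \<open>I_Q\<close> and a cofinal sequence in it\<close>

lemma I_Q_dense:
  assumes "l \<in> I_Q" and "m \<in> I_Q"
  obtains k where "k \<in> I_Q" "l < k" "m < k"
proof -
  have "max l m < 1" "0 < max l m" using assms by (auto simp: I_Q_def)
  then obtain k where "max l m < k" "k < 1" using dense by blast
  with \<open>0 < max l m\<close> show thesis by (intro that[of k]) (auto simp: I_Q_def)
qed

lemma I_Q_finite_bound:
  assumes "finite A" "A \<subseteq> I_Q"
  obtains k where "k \<in> I_Q" "\<And>l. l \<in> A \<Longrightarrow> l < k"
proof -
  have "\<exists>k\<in>I_Q. \<forall>l\<in>A. l < k"
    using assms
  proof (induction rule: finite_induct)
    case empty
    have "1/2 \<in> I_Q" by (simp add: I_Q_def)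
    then show ?case by blast
  next
    case (insert x F)
    then obtain k where k: "k \<in> I_Q" "\<forall>l\<in>F. l < k" by auto
    obtain k' where "k' \<in> I_Q" "x < k'" "k < k'"
      using I_Q_dense[of x k] insert.prems k(1) by auto
    with k show ?case by (intro bexI[of _ k']) auto
  qed
  then show thesis using that by blast
qed

lemma I_Q_mult: "\<lbrakk>k \<in> I_Q; l \<in> I_Q\<rbrakk> \<Longrightarrow> k * l \<in> I_Q"
  using mult_strict_mono[of k 1 l 1] by (simp add: I_Q_def)

lemma I_Q_mult_less: "\<lbrakk>k \<in> I_Q; l \<in> I_Q\<rbrakk> \<Longrightarrow> k * l < k"
  by (simp add: I_Q_def)

text \<open>A fixed strictly increasing sequence in \<open>I_Q\<close> that tends to 1. The summand
  2 makes it start at 1/2; with 1 in its place the first value would be 0, outside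
  \<open>I_Q\<close>.\<close>

definition cutoff :: "nat \<Rightarrow> rat" where
  "cutoff n = 1 - 1 / (of_nat n + 2)"

lemma cutoff_I_Q: "cutoff n \<in> I_Q"
  by (simp add: cutoff_def I_Q_def field_simps)

lemma cutoff_strict_mono: "cutoff n < cutoff (Suc n)"
  by (simp add: cutoff_def field_simps)

text \<open>The lower bound \<open>k\<close> on the index serves the construction of limits, where
  the stage must be late enough both for the parameter \<open>l\<close> and for the path
  \<open>F k\<close>.\<close>

lemma cutoff_cofinal:
  assumes "l \<in> I_Q"
  shows "\<exists>n\<ge>k. l < cutoff n"
proof -
  have pos: "0 < 1 - l" using assms by (simp add: I_Q_def)
  obtain m :: nat where m: "1 / (1 - l) < of_nat m" using reals_Archimedean2 by blast
  define n where "n = max k m"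
  have "1 / (1 - l) < of_nat n + 2"
  proof -
    have "(of_nat m :: rat) \<le> of_nat n" by (simp add: n_def)
    with m show ?thesis by linarith
  qed
  then have "1 / (of_nat n + 2) < 1 - l" using pos by (simp add: field_simps)
  then have "l < cutoff n" by (simp add: cutoff_def)
  moreover have "k \<le> n" by (simp add: n_def)
  ultimately show ?thesis by blast
qed

section \<open>The internal hom is a Cu-semigroup\<close>

locale cu_pair = S: cu_semigroup S + T: cu_semigroup T
  for S :: "('a, 'm) ordered_monoid_scheme" and T :: "('b, 'n) ordered_monoid_scheme"
begin

abbreviation prec (infix "\<prec>" 50) where
  "\<phi> \<prec> \<psi> \<equiv> precedes S T \<phi> \<psi>"

abbreviation lesssim (infix "\<lesssim>" 50) where
  "f \<lesssim> g \<equiv> path_lesssim S T f g"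

section \<open>Generalized Cu-morphisms and the relation \<open>\<prec>\<close>\<close>

lemma Cu_iff: "f \<in> Cu S T \<longleftrightarrow> generalized_cu_morphism S T f"
  by (simp add: Cu_def)

lemma Cu_closed: "\<lbrakk>f \<in> Cu S T; a \<in> carrier S\<rbrakk> \<Longrightarrow> f a \<in> carrier T"
  using generalized_cu_morphism.maps[of S T f] by (auto simp: Cu_iff)

lemma Cu_extensional: "f \<in> Cu S T \<Longrightarrow> f \<in> extensional (carrier S)"
  using generalized_cu_morphism.maps[of S T f] by (auto simp: Cu_iff PiE_def)

lemma Cu_leq: "\<lbrakk>f \<in> Cu S T; a \<in> carrier S; b \<in> carrier S; a \<preceq>\<^bsub>S\<^esub> b\<rbrakk> \<Longrightarrow> f a \<preceq>\<^bsub>T\<^esub> f b"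
  using generalized_cu_morphism.map_leq[of S T f] by (auto simp: Cu_iff)

lemma Cu_increasing: "\<lbrakk>f \<in> Cu S T; increasing S c\<rbrakk> \<Longrightarrow> increasing T (\<lambda>n. f (c n))"
  using Cu_closed Cu_leq by (simp add: increasing_def)

lemma Cu_sup: "\<lbrakk>f \<in> Cu S T; increasing S c; is_sup S c s\<rbrakk> \<Longrightarrow> is_sup T (\<lambda>n. f (c n)) (f s)"
  using generalized_cu_morphism.map_sup[of S T f] by (auto simp: Cu_iff)

text \<open>The pointwise sum preserves suprema by (O4) in \<open>T\<close>; the other conditions
  hold argument by argument.\<close>

lemma Cu_add:
  assumes f: "f \<in> Cu S T" and g: "g \<in> Cu S T"
  shows "(\<lambda>a \<in> carrier S. f a \<oplus>\<^bsub>T\<^esub> g a) \<in> Cu S T"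
proof -
  interpret f: generalized_cu_morphism S T f using f by (simp add: Cu_iff)
  interpret g: generalized_cu_morphism S T g using g by (simp add: Cu_iff)
  have "generalized_cu_morphism S T (\<lambda>a \<in> carrier S. f a \<oplus>\<^bsub>T\<^esub> g a)"
  proof unfold_locales
    show "(\<lambda>a\<in>carrier S. f a \<oplus>\<^bsub>T\<^esub> g a) \<in> carrier S \<rightarrow>\<^sub>E carrier T"
      using f g Cu_closed by auto
  next
    fix a b assume "a \<in> carrier S" "b \<in> carrier S"
    then show "(\<lambda>a\<in>carrier S. f a \<oplus>\<^bsub>T\<^esub> g a) (a \<oplus>\<^bsub>S\<^esub> b) =
        (\<lambda>a\<in>carrier S. f a \<oplus>\<^bsub>T\<^esub> g a) a \<oplus>\<^bsub>T\<^esub> (\<lambda>a\<in>carrier S. f a \<oplus>\<^bsub>T\<^esub> g a) b"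
      using f g Cu_closed by (simp add: f.map_add g.map_add T.m_ac)
  next
    show "(\<lambda>a\<in>carrier S. f a \<oplus>\<^bsub>T\<^esub> g a) \<zero>\<^bsub>S\<^esub> = \<zero>\<^bsub>T\<^esub>"
      by (simp add: f.map_zero g.map_zero)
  next
    fix a b assume "a \<in> carrier S" "b \<in> carrier S" "a \<preceq>\<^bsub>S\<^esub> b"
    then show "(\<lambda>a\<in>carrier S. f a \<oplus>\<^bsub>T\<^esub> g a) a \<preceq>\<^bsub>T\<^esub> (\<lambda>a\<in>carrier S. f a \<oplus>\<^bsub>T\<^esub> g a) b"
      using f g Cu_closed by (simp add: f.map_leq g.map_leq T.add_mono2)
  next
    fix c s assume c: "increasing S c" "is_sup S c s"
    then have "is_sup T (\<lambda>n. f (c n) \<oplus>\<^bsub>T\<^esub> g (c n)) (f s \<oplus>\<^bsub>T\<^esub> g s)"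
      using f g by (intro T.O4 Cu_increasing Cu_sup)
    moreover have "\<And>n. c n \<in> carrier S" "s \<in> carrier S"
      using c by (auto simp: increasing_def is_sup_def)
    ultimately show "is_sup T (\<lambda>n. (\<lambda>a\<in>carrier S. f a \<oplus>\<^bsub>T\<^esub> g a) (c n))
        ((\<lambda>a\<in>carrier S. f a \<oplus>\<^bsub>T\<^esub> g a) s)" by simp
  qed
  then show ?thesis by (simp add: Cu_iff)
qed

lemma Cu_zero: "(\<lambda>a \<in> carrier S. \<zero>\<^bsub>T\<^esub>) \<in> Cu S T"
proof -
  have "generalized_cu_morphism S T (\<lambda>a \<in> carrier S. \<zero>\<^bsub>T\<^esub>)"
    by unfold_locales
      (auto simp: increasing_def is_sup_def T.leq_refl)
  then show ?thesis by (simp add: Cu_iff)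
qed

text \<open>The relation \<open>\<prec>\<close> speaks only of pairs \<open>a' \<lless> a\<close>.
  Writing \<open>a\<close> as a supremum of elements \<open>c n \<lless> a\<close> bounds every
  \<open>\<phi> (c n)\<close> by \<open>\<psi> a\<close>, and \<open>\<phi>\<close> preserves that
  supremum.\<close>

lemma prec_imp_leq:
  assumes "\<phi> \<in> Cu S T" "\<psi> \<in> Cu S T" "\<phi> \<prec> \<psi>" and a: "a \<in> carrier S"
  shows "\<phi> a \<preceq>\<^bsub>T\<^esub> \<psi> a"
proof -
  obtain c where c: "increasing S c" "\<And>n. c n \<in> carrier S" "\<And>n. c n \<lless>\<^bsub>S\<^esub> a" "is_sup S c a"
    using S.way_below_sequenceE[OF a] by metis
  have "\<phi> (c n) \<preceq>\<^bsub>T\<^esub> \<psi> a" for n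
  proof -
    have "\<phi> (c n) \<lless>\<^bsub>T\<^esub> \<psi> a" using assms c by (simp add: precedes_def)
    then show ?thesis using assms Cu_closed T.way_below_imp_leq by blast
  qed
  moreover have "is_sup T (\<lambda>n. \<phi> (c n)) (\<phi> a)" using Cu_sup assms c by blast
  ultimately show ?thesis using Cu_closed assms by (auto simp: is_sup_def)
qed

text \<open>For \<open>a' \<lless> a\<close>, the pointwise inequality
  \<open>\<phi> a' \<le> \<psi> a'\<close> followed by \<open>\<psi> a' \<lless> \<chi> a\<close>
  gives the claim.\<close>

lemma prec_trans:
  assumes "\<phi> \<in> Cu S T" "\<psi> \<in> Cu S T" "\<phi> \<prec> \<psi>" "\<psi> \<prec> \<chi>"
  shows "\<phi> \<prec> \<chi>"
  unfolding precedes_def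
proof (intro ballI impI)
  fix a' a assume "a' \<in> carrier S" "a \<in> carrier S" "a' \<lless>\<^bsub>S\<^esub> a"
  then show "\<phi> a' \<lless>\<^bsub>T\<^esub> \<chi> a"
    using assms prec_imp_leq Cu_closed T.leq_way_below_trans[of "\<phi> a'" "\<psi> a'" "\<chi> a"]
    by (simp add: precedes_def)
qed

lemma prec_add:
  assumes "\<phi> \<in> Cu S T" "\<psi> \<in> Cu S T" "\<phi>' \<in> Cu S T" "\<psi>' \<in> Cu S T" "\<phi> \<prec> \<psi>" "\<phi>' \<prec> \<psi>'"
  shows "(\<lambda>a \<in> carrier S. \<phi> a \<oplus>\<^bsub>T\<^esub> \<phi>' a) \<prec> (\<lambda>a \<in> carrier S. \<psi> a \<oplus>\<^bsub>T\<^esub> \<psi>' a)"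
  using assms T.O3 Cu_closed by (simp add: precedes_def)

lemma prec_zero: "(\<lambda>a \<in> carrier S. \<zero>\<^bsub>T\<^esub>) \<prec> \<psi>"
  by (simp add: precedes_def T.zero_way_below)

section \<open>Paths, their comparison and their sum\<close>

lemma path_Cu: "\<lbrakk>f \<in> cu_paths S T; l \<in> I_Q\<rbrakk> \<Longrightarrow> f l \<in> Cu S T"
  by (auto simp: cu_paths_def)

lemma path_prec: "\<lbrakk>f \<in> cu_paths S T; l \<in> I_Q; m \<in> I_Q; l < m\<rbrakk> \<Longrightarrow> f l \<prec> f m"
  by (simp add: cu_paths_def)

lemma path_prec_trans:
  assumes "f \<in> cu_paths S T" "g \<in> cu_paths S T" "l \<in> I_Q" "m \<in> I_Q" "f l \<prec> g m" "g m \<prec> \<chi>"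
  shows "f l \<prec> \<chi>"
  using assms by (intro prec_trans[of "f l" "g m" \<chi>]) (simp_all add: path_Cu)

lemma path_add_closed:
  assumes "f \<in> cu_paths S T" "g \<in> cu_paths S T"
  shows "path_add S T f g \<in> cu_paths S T"
  unfolding cu_paths_def
proof (intro CollectI conjI ballI impI)
  show "path_add S T f g \<in> I_Q \<rightarrow>\<^sub>E Cu S T"
    using assms Cu_add path_Cu by (auto simp: path_add_def)
  show "path_add S T f g l' \<prec> path_add S T f g l" if "l' \<in> I_Q" "l \<in> I_Q" "l' < l" for l' l
    using that assms by (simp add: path_add_def prec_add path_Cu path_prec)
qed

abbreviation path_zero :: "rat \<Rightarrow> 'a \<Rightarrow> 'b" where
  "path_zero \<equiv> \<lambda>l \<in> I_Q. \<lambda>a \<in> carrier S. \<zero>\<^bsub>T\<^esub>"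

lemma path_zero_closed: "path_zero \<in> cu_paths S T"
  by (simp add: cu_paths_def Cu_zero prec_zero)

text \<open>A morphism \<open>f l\<close> need not satisfy \<open>f l \<prec> f l\<close>, so each
  \<open>f l\<close> is compared with \<open>f m\<close> for a strictly larger
  \<open>m\<close>.\<close>

lemma lesssim_refl: "f \<in> cu_paths S T \<Longrightarrow> f \<lesssim> f"
  unfolding path_lesssim_def
proof
  fix l assume f: "f \<in> cu_paths S T" and l: "l \<in> I_Q"
  obtain m where "m \<in> I_Q" "l < m" using I_Q_dense[OF l l] by blast
  then show "\<exists>m\<in>I_Q. f l \<prec> f m" using path_prec[OF f l] by auto
qed

lemma lesssimE:
  assumes "f \<lesssim> g" "l \<in> I_Q"
  obtains m where "m \<in> I_Q" "f l \<prec> g m"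
  using assms by (auto simp: path_lesssim_def)

lemma lesssim_trans:
  assumes "f \<in> cu_paths S T" "g \<in> cu_paths S T" "f \<lesssim> g" "g \<lesssim> h"
  shows "f \<lesssim> h"
  unfolding path_lesssim_def
proof
  fix l assume l: "l \<in> I_Q"
  obtain m where m: "m \<in> I_Q" "f l \<prec> g m" using lesssimE[OF assms(3) l] .
  obtain k where k: "k \<in> I_Q" "g m \<prec> h k" using lesssimE[OF assms(4) m(1)] .
  have "f l \<prec> h k" by (rule path_prec_trans[OF assms(1,2) l m k(2)])
  then show "\<exists>k\<in>I_Q. f l \<prec> h k" using k(1) by blast
qed

lemma path_zero_lesssim: "f \<in> cu_paths S T \<Longrightarrow> path_zero \<lesssim> f"
  unfolding path_lesssim_def using prec_zero by auto

text \<open>The two summands may be dominated at different parameters \<open>l\<close> and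
  \<open>k'\<close>. Both are moved up to a common larger \<open>m\<close>, where (O3) adds the two
  relations.\<close>

lemma path_add_prec:
  assumes "f \<in> cu_paths S T" "g \<in> cu_paths S T" "f' \<in> cu_paths S T" "g' \<in> cu_paths S T"
    and "k \<in> I_Q" "l \<in> I_Q" "m \<in> I_Q" "k' \<in> I_Q" "l < m" "k' < m"
    and "f k \<prec> f' l" "g k \<prec> g' k'"
  shows "path_add S T f g k \<prec> path_add S T f' g' m"
proof -
  have "f' l \<prec> f' m" "g' k' \<prec> g' m" using assms by (simp_all add: path_prec)
  then have "f k \<prec> f' m" "g k \<prec> g' m"
    using path_prec_trans[of f f' k l "f' m"] path_prec_trans[of g g' k k' "g' m"] assms by simp_all
  then show ?thesis using assms by (simp add: path_add_def prec_add path_Cu)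
qed

lemma path_add_lesssim:
  assumes "f \<in> cu_paths S T" "g \<in> cu_paths S T" "f' \<in> cu_paths S T" "g' \<in> cu_paths S T"
    and "f \<lesssim> f'" "g \<lesssim> g'"
  shows "path_add S T f g \<lesssim> path_add S T f' g'"
  unfolding path_lesssim_def
proof
  fix k assume k: "k \<in> I_Q"
  obtain l where l: "l \<in> I_Q" "f k \<prec> f' l" using lesssimE[OF assms(5) k] .
  obtain l' where l': "l' \<in> I_Q" "g k \<prec> g' l'" using lesssimE[OF assms(6) k] .
  obtain m where m: "m \<in> I_Q" "l < m" "l' < m" using I_Q_dense[OF l(1) l'(1)] .
  have "path_add S T f g k \<prec> path_add S T f' g' m"
    using path_add_prec[OF assms(1-4) k l(1) m(1) l'(1) m(2,3) l(2) l'(2)] .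
  then show "\<exists>m\<in>I_Q. path_add S T f g k \<prec> path_add S T f' g' m" using m(1) by blast
qed

lemma path_add_comm:
  assumes "f \<in> cu_paths S T" "g \<in> cu_paths S T"
  shows "path_add S T f g = path_add S T g f"
  using assms path_Cu Cu_closed
  by (auto simp: path_add_def T.m_comm intro!: restrict_ext)

lemma path_add_assoc:
  assumes "f \<in> cu_paths S T" "g \<in> cu_paths S T" "h \<in> cu_paths S T"
  shows "path_add S T (path_add S T f g) h = path_add S T f (path_add S T g h)"
  using assms path_Cu Cu_closed
  by (auto simp: path_add_def T.m_assoc intro!: restrict_ext)

text \<open>Both sides are extensional in the parameter and in the argument, so the neutral law
  holds as an equality of paths and not merely of their classes.\<close>

lemma path_add_zero:
  assumes "f \<in> cu_paths S T"
  shows "path_add S T path_zero f = f"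
proof (rule extensionalityI[of _ I_Q])
  show "path_add S T path_zero f \<in> extensional I_Q" by (simp add: path_add_def)
  show "f \<in> extensional I_Q" using assms by (simp add: cu_paths_def PiE_def)
  fix l assume l: "l \<in> I_Q"
  then have f: "f l \<in> Cu S T" using assms path_Cu by blast
  show "path_add S T path_zero f l = f l"
  proof (rule extensionalityI[of _ "carrier S"])
    show "path_add S T path_zero f l \<in> extensional (carrier S)" using l by (simp add: path_add_def)
    show "f l \<in> extensional (carrier S)" using f Cu_extensional by blast
    show "path_add S T path_zero f l a = f l a" if "a \<in> carrier S" for a
      using that l f Cu_closed by (simp add: path_add_def)
  qed
qed

section \<open>Classes of paths as a positively ordered semigroup\<close>

lemma path_equiv: "equiv (cu_paths S T) (path_rel S T)"
proof (rule equivI)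
  show "path_rel S T \<subseteq> cu_paths S T \<times> cu_paths S T" by (auto simp: path_rel_def)
  show "refl_on (cu_paths S T) (path_rel S T)"
    by (rule refl_onI) (simp add: path_rel_def lesssim_refl)
  show "sym (path_rel S T)" by (rule symI) (simp add: path_rel_def)
  show "trans (path_rel S T)"
  proof (rule transI)
    fix f g h assume "(f, g) \<in> path_rel S T" "(g, h) \<in> path_rel S T"
    then show "(f, h) \<in> path_rel S T"
      using lesssim_trans[of f g h] lesssim_trans[of h g f] by (simp add: path_rel_def)
  qed
qed

lemma path_class_eq_iff:
  assumes "f \<in> cu_paths S T" "g \<in> cu_paths S T"
  shows "path_class S T f = path_class S T g \<longleftrightarrow> f \<lesssim> g \<and> g \<lesssim> f"
  using assms eq_equiv_class_iff[OF path_equiv] by (simp add: path_class_def path_rel_def)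

lemma mem_path_class_iff:
  "g \<in> path_class S T f \<longleftrightarrow> f \<in> cu_paths S T \<and> g \<in> cu_paths S T \<and> f \<lesssim> g \<and> g \<lesssim> f"
  by (simp add: path_class_def path_rel_def)

abbreviation ihom where "ihom \<equiv> internal_hom S T"

lemma hom_carrier_iff: "x \<in> carrier ihom \<longleftrightarrow> (\<exists>f \<in> cu_paths S T. x = path_class S T f)"
  by (auto simp: internal_hom_def path_class_def elim!: quotientE intro: quotientI)

lemma hom_carrierE:
  assumes "x \<in> carrier ihom"
  obtains f where "f \<in> cu_paths S T" "x = path_class S T f"
  using assms hom_carrier_iff by blast

lemma path_class_closed: "f \<in> cu_paths S T \<Longrightarrow> path_class S T f \<in> carrier ihom"
  using hom_carrier_iff by blast

text \<open>Paths in one class bound each other, so a comparison between some representatives passes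
  to the given ones by transitivity.\<close>

lemma hom_leq_iff:
  assumes "f \<in> cu_paths S T" "g \<in> cu_paths S T"
  shows "path_class S T f \<preceq>\<^bsub>ihom\<^esub> path_class S T g \<longleftrightarrow> f \<lesssim> g"
proof
  assume "path_class S T f \<preceq>\<^bsub>ihom\<^esub> path_class S T g"
  then obtain f' g' where "f' \<in> path_class S T f" "g' \<in> path_class S T g" "f' \<lesssim> g'"
    by (auto simp: internal_hom_def)
  then show "f \<lesssim> g"
    using lesssim_trans[of f f' g'] lesssim_trans[of f g' g] by (simp add: mem_path_class_iff)
next
  assume "f \<lesssim> g"
  moreover have "f \<in> path_class S T f" "g \<in> path_class S T g"
    using assms by (simp_all add: mem_path_class_iff lesssim_refl)
  ultimately show "path_class S T f \<preceq>\<^bsub>ihom\<^esub> path_class S T g"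
    by (auto simp: internal_hom_def)
qed

text \<open>Sums of equivalent paths are equivalent, so all members of the defining union coincide;
  there is at least one, since a path lies in its own class.\<close>

lemma hom_add:
  assumes "f \<in> cu_paths S T" "g \<in> cu_paths S T"
  shows "path_class S T f \<oplus>\<^bsub>ihom\<^esub> path_class S T g = path_class S T (path_add S T f g)"
proof -
  have "path_class S T (path_add S T f' g') = path_class S T (path_add S T f g)"
    if "f' \<in> path_class S T f" "g' \<in> path_class S T g" for f' g'
    using that by (simp add: mem_path_class_iff path_class_eq_iff path_add_closed path_add_lesssim)
  moreover have "f \<in> path_class S T f" "g \<in> path_class S T g"
    using assms by (simp_all add: mem_path_class_iff lesssim_refl)
  ultimately have "(\<Union>f'\<in>path_class S T f. \<Union>g'\<in>path_class S T g. path_class S T (path_add S T f' g')) =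
      path_class S T (path_add S T f g)" by blast
  then show ?thesis by (simp add: internal_hom_def)
qed

lemma hom_zero: "\<zero>\<^bsub>ihom\<^esub> = path_class S T path_zero"
  by (simp add: internal_hom_def)

lemma hom_pos_ordered_semigroup: "pos_ordered_semigroup ihom"
proof (unfold_locales, goal_cases)
  \<comment> \<open>Cases 1 to 6 are the commutative monoid laws, cases 7 to 11 the laws of the
    order.\<close>
  case (1 x y)
  then show ?case
    by (auto elim!: hom_carrierE simp: hom_add path_add_closed path_class_closed)
next
  case (2 x y z)
  then show ?case
    by (auto elim!: hom_carrierE simp: hom_add path_add_closed path_add_assoc)
next
  case 3
  then show ?case by (simp add: hom_zero path_class_closed path_zero_closed)
next
  case (4 x)
  then show ?case
    by (auto elim!: hom_carrierE simp: hom_zero hom_add path_zero_closed path_add_zero)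
next
  case (5 x)
  then show ?case
    by (auto elim!: hom_carrierE
        simp: hom_zero hom_add path_zero_closed path_add_zero path_add_comm[of _ path_zero])
next
  case (6 x y)
  then show ?case by (auto elim!: hom_carrierE simp: hom_add path_add_comm)
next
  case (7 a)
  then show ?case by (auto elim!: hom_carrierE simp: hom_leq_iff lesssim_refl)
next
  case (8 a b)
  then obtain f g where "f \<in> cu_paths S T" "a = path_class S T f"
    "g \<in> cu_paths S T" "b = path_class S T g" by (auto elim!: hom_carrierE)
  with 8 show ?case by (simp add: hom_leq_iff path_class_eq_iff)
next
  case (9 a b c)
  then obtain f g h where "f \<in> cu_paths S T" "a = path_class S T f"
    "g \<in> cu_paths S T" "b = path_class S T g" "h \<in> cu_paths S T" "c = path_class S T h"
    by (auto elim!: hom_carrierE)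
  with 9 show ?case using lesssim_trans[of f g h] by (simp add: hom_leq_iff)
next
  case (10 a b c)
  then show ?case
    by (auto elim!: hom_carrierE
        simp: hom_leq_iff hom_add path_add_closed path_add_lesssim lesssim_refl)
next
  case (11 a)
  then show ?case
    by (auto elim!: hom_carrierE simp: hom_zero hom_leq_iff path_zero_closed path_zero_lesssim)
qed

section \<open>Suprema of increasing sequences of classes\<close>

lemma path_lesssim_chain:
  assumes "\<And>n. F n \<in> cu_paths S T" "\<And>n. F n \<lesssim> F (Suc n)" "m \<le> n"
  shows "F m \<lesssim> F n"
  using assms(3)
proof (induction rule: dec_induct)
  case base
  then show ?case using assms(1) by (rule lesssim_refl)
next
  case (step k)
  show ?case by (rule lesssim_trans[OF assms(1) assms(1) step.IH assms(2)])
qed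

text \<open>The supremum expressed on representatives. In place of comparing \<open>h\<close> with
  all upper bounds, it asks that each single \<open>h m\<close> be dominated already at a finite
  stage \<open>F n\<close>, which is the form used in computations with (O3), (O4) and
  way-below.\<close>

definition path_limit :: "(nat \<Rightarrow> rat \<Rightarrow> 'a \<Rightarrow> 'b) \<Rightarrow> (rat \<Rightarrow> 'a \<Rightarrow> 'b) \<Rightarrow> bool" where
  "path_limit F h \<longleftrightarrow> (\<forall>n. F n \<lesssim> h) \<and> (\<forall>m \<in> I_Q. \<exists>n. \<exists>l \<in> I_Q. h m \<prec> F n l)"

text \<open>
  The limit runs through a piece of \<open>F 0\<close>, then a piece of \<open>F 1\<close>, and so on: the piece of
  \<open>F n\<close> has parameters between \<open>s n\<close> and \<open>r n\<close>, where \<open>s (Suc n)\<close> is so large that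
  \<open>F (Suc n)\<close> at it dominates \<open>F k\<close> at \<open>r n\<close> for all \<open>k \<le> n\<close>, and \<open>r n\<close> tends to 1. A parameter
  \<open>l\<close> lies in piece number \<open>\<lfloor>l / (1 - l)\<rfloor>\<close>; each piece uses only the upper half of its interval, which
  keeps the comparison with \<open>F n (s n)\<close> strict.
\<close>

lemma path_limit_exists:
  assumes F: "\<And>n. F n \<in> cu_paths S T" and chain: "\<And>n. F n \<lesssim> F (Suc n)"
  shows "\<exists>h \<in> cu_paths S T. path_limit F h"
proof -
  \<comment> \<open>The midpoint between \<open>max x (cutoff n)\<close> and 1: it stays in
    \<open>I_Q\<close>, exceeds \<open>x\<close>, and is forced towards 1 as \<open>n\<close>
    grows.\<close>
  define R where "R n x = (max x (cutoff n) + 1) / 2" for n and x :: rat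
  have R: "R n x \<in> I_Q" "x < R n x" "cutoff n < R n x" if "x \<in> I_Q" for n x
    using that cutoff_I_Q[of n] by (auto simp: R_def I_Q_def field_simps max_def)
  have "\<exists>y. y \<in> I_Q \<and> (\<forall>k\<le>n. F k (R n x) \<prec> F (Suc n) y)" if x: "x \<in> I_Q" for n x
  proof -
    \<comment> \<open>Each \<open>k \<le> n\<close> has its own dominating parameter of
      \<open>F (Suc n)\<close>; there are finitely many, so one larger parameter serves them
      all.\<close>
    have "\<exists>y. y \<in> I_Q \<and> F k (R n x) \<prec> F (Suc n) y" if "k \<le> n" for k
    proof -
      have "F k \<lesssim> F (Suc n)" using path_lesssim_chain[of F k "Suc n"] F chain that by simp
      then show ?thesis using R(1)[OF x] by (auto elim: lesssimE)
    qed
    then obtain y where y: "\<And>k. k \<le> n \<Longrightarrow> y k \<in> I_Q \<and> F k (R n x) \<prec> F (Suc n) (y k)"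
      by metis
    obtain z where z: "z \<in> I_Q" "\<And>l. l \<in> y ` {..n} \<Longrightarrow> l < z"
      using I_Q_finite_bound[of "y ` {..n}"] y by auto
    have "F k (R n x) \<prec> F (Suc n) z" if k: "k \<le> n" for k
    proof (rule path_prec_trans[OF F F R(1)[OF x]])
      show "y k \<in> I_Q" "F k (R n x) \<prec> F (Suc n) (y k)" using y[OF k] by simp_all
      then show "F (Suc n) (y k) \<prec> F (Suc n) z" using path_prec[OF F _ z(1)] z(2) k by simp
    qed
    with z(1) show ?thesis by blast
  qed
  \<comment> \<open>The dependent choice requires an admissible starting value.\<close>
  moreover have "cutoff 0 \<in> I_Q" by (rule cutoff_I_Q)
  ultimately obtain s where s: "\<And>n. s n \<in> I_Q"
    and dom: "\<And>n k. k \<le> n \<Longrightarrow> F k (R n (s n)) \<prec> F (Suc n) (s (Suc n))"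
    using dependent_nat_choice[of "\<lambda>_ x. x \<in> I_Q"
        "\<lambda>n x y. \<forall>k\<le>n. F k (R n x) \<prec> F (Suc n) y"]
    by metis
  define r where "r n = R n (s n)" for n
  have r: "r n \<in> I_Q" "s n < r n" "cutoff n < r n" for n
    using R s by (simp_all add: r_def)
  \<comment> \<open>The end of piece \<open>m\<close> is dominated by the start of every later
    piece. The induction descends from \<open>m = n - 1\<close> and crosses one piece at a time,
    from \<open>s (Suc i)\<close> to \<open>r (Suc i)\<close>.\<close>
  have step: "F m (r m) \<prec> F n (s n)" if "m < n" for m n
    using that
  proof (induction rule: strict_inc_induct)
    case (base i)
    then show ?case using dom[of i i] by (simp add: r_def)
  next
    case (step i)
    have "F i (r i) \<prec> F (Suc i) (s (Suc i))" using dom[of i i] by (simp add: r_def)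
    moreover have "F (Suc i) (s (Suc i)) \<prec> F n (s n)"
      by (rule path_prec_trans[OF F F s r(1) path_prec[OF F s r(1) r(2)] step.IH])
    ultimately show ?case by (rule path_prec_trans[OF F F r(1) s])
  qed
  \<comment> \<open>\<open>X\<close> maps \<open>I_Q\<close> increasingly onto the positive
    rationals. The integer part of \<open>X l\<close> selects the piece, and the fractional part
    \<open>t\<close> enters \<open>P l\<close> as the weight \<open>(1 + t) / 2\<close> in [1/2, 1),
    which keeps \<open>P l\<close> strictly above \<open>s (N l)\<close> even when
    \<open>t = 0\<close>.\<close>
  define X where "X l = l / (1 - l)" for l :: rat
  define N where "N l = nat \<lfloor>X l\<rfloor>" for l
  define P where "P l = s (N l) + (1 + (X l - of_nat (N l))) / 2 * (r (N l) - s (N l))" for l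
  define h where "h = (\<lambda>l \<in> I_Q. F (N l) (P l))"
  have X_pos: "0 < X l" if "l \<in> I_Q" for l using that by (simp add: X_def I_Q_def)
  have N: "of_nat (N l) \<le> X l" "X l < of_nat (N l) + 1" if "l \<in> I_Q" for l
    using X_pos[OF that] floor_correct[of "X l"] by (simp_all add: N_def)
  have X_mono: "X l < X m" if "l \<in> I_Q" "m \<in> I_Q" "l < m" for l m
    using that by (simp add: X_def I_Q_def field_simps)
  have P_bounds: "s (N l) < P l" "P l < r (N l)" if l: "l \<in> I_Q" for l
  proof -
    define t where "t = (1 + (X l - of_nat (N l))) / 2"
    have t: "0 < t" "t < 1" using N[OF l] by (simp_all add: t_def)
    have d: "0 < r (N l) - s (N l)" using r(2) by simp
    have "0 < t * (r (N l) - s (N l))" using t(1) d by simp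
    then show "s (N l) < P l" by (simp add: P_def t_def)
    have "t * (r (N l) - s (N l)) < 1 * (r (N l) - s (N l))"
      using t(2) d by (rule mult_strict_right_mono)
    then show "P l < r (N l)" by (simp add: P_def t_def)
  qed
  have P: "P l \<in> I_Q" if "l \<in> I_Q" for l
    using P_bounds[OF that] s[of "N l"] r(1)[of "N l"] by (simp add: I_Q_def)
  have h_path: "h \<in> cu_paths S T"
    unfolding cu_paths_def
  proof (intro CollectI conjI ballI impI)
    show "h \<in> I_Q \<rightarrow>\<^sub>E Cu S T" using F P path_Cu by (auto simp: h_def)
    fix l m assume l: "l \<in> I_Q" and m: "m \<in> I_Q" and lm: "l < m"
    have Xlm: "X l < X m" using X_mono l m lm by blast
    then have "N l \<le> N m" by (simp add: N_def floor_mono nat_mono)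
    \<comment> \<open>Within one piece \<open>P\<close> is strictly increasing. Between different
      pieces the comparison passes through the end \<open>r (N l)\<close> of the earlier piece and
      the start \<open>s (N m)\<close> of the later one.\<close>
    then consider "N l = N m" | "N l < N m" by linarith
    then have "F (N l) (P l) \<prec> F (N m) (P m)"
    proof cases
      case 1
      have "P l < P m"
        using Xlm r(2)[of "N m"] 1 by (simp add: P_def mult_strict_right_mono)
      then show ?thesis using path_prec[OF F P[OF l] P[OF m]] 1 by simp
    next
      case 2
      have "F (N l) (P l) \<prec> F (N l) (r (N l))"
        by (rule path_prec[OF F P[OF l] r(1) P_bounds(2)[OF l]])
      moreover have "F (N l) (r (N l)) \<prec> F (N m) (P m)"
        by (rule path_prec_trans[OF F F r(1) s step[OF 2]
              path_prec[OF F s P[OF m] P_bounds(1)[OF m]]])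
      ultimately show ?thesis by (rule path_prec_trans[OF F F P[OF l] r(1)])
    qed
    then show "h l \<prec> h m" using l m by (simp add: h_def)
  qed
  have "F k \<lesssim> h" for k
    unfolding path_lesssim_def
  proof
    fix l assume l: "l \<in> I_Q"
    obtain n where n: "n \<ge> k" "l < cutoff n" using cutoff_cofinal[OF l] by blast
    \<comment> \<open>This is the solution of \<open>X m = Suc n\<close>, so \<open>h m\<close>
      belongs to piece \<open>Suc n\<close>. The comparison runs from \<open>F k l\<close> to
      \<open>F k (r n)\<close>, as \<open>l < cutoff n < r n\<close>, then to
      \<open>F (Suc n) (s (Suc n))\<close>, as \<open>k \<le> n\<close>, and from there to
      \<open>h m\<close>.\<close>
    define m :: rat where "m = of_nat (Suc n) / of_nat (Suc (Suc n))"
    have m: "m \<in> I_Q" by (simp add: m_def I_Q_def field_simps)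
    have "X m = of_nat (Suc n)" by (simp add: X_def m_def field_simps)
    then have Nm: "N m = Suc n" by (simp only: N_def floor_of_nat nat_int)
    have "F k (r n) \<prec> F (Suc n) (s (Suc n))" using dom[OF n(1)] by (simp add: r_def)
    moreover have "F (Suc n) (s (Suc n)) \<prec> h m"
      using path_prec[OF F s P[OF m]] P_bounds(1)[OF m] m by (simp add: h_def Nm)
    ultimately have "F k (r n) \<prec> h m" by (rule path_prec_trans[OF F F r(1) s])
    then have "F k l \<prec> h m"
      by (rule path_prec_trans[OF F F l r(1)
            path_prec[OF F l r(1) less_trans[OF n(2) r(3)]]])
    with m show "\<exists>m\<in>I_Q. F k l \<prec> h m" by blast
  qed
  moreover have "\<exists>n. \<exists>l\<in>I_Q. h m \<prec> F n l" if "m \<in> I_Q" for m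
  proof -
    have "h m \<prec> F (N m) (r (N m))"
      using path_prec[OF F P[OF that] r(1) P_bounds(2)[OF that]] that by (simp add: h_def)
    then show ?thesis using r(1) by blast
  qed
  ultimately have "path_limit F h" by (simp add: path_limit_def)
  with h_path show ?thesis by blast
qed

lemma hom_increasingE:
  assumes "increasing ihom c"
  obtains F where "\<And>n. F n \<in> cu_paths S T" "\<And>n. c n = path_class S T (F n)"
    "\<And>n. F n \<lesssim> F (Suc n)"
proof -
  have "\<forall>n. \<exists>f. f \<in> cu_paths S T \<and> c n = path_class S T f"
    using assms hom_carrierE unfolding increasing_def by metis
  then obtain F where F: "\<And>n. F n \<in> cu_paths S T" "\<And>n. c n = path_class S T (F n)" by metis
  moreover have "F n \<lesssim> F (Suc n)" for n
    using assms F hom_leq_iff by (metis increasing_def)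
  ultimately show thesis using that by blast
qed

lemma path_limit_is_sup:
  assumes "\<And>n. F n \<in> cu_paths S T" "h \<in> cu_paths S T" "path_limit F h"
  shows "is_sup ihom (\<lambda>n. path_class S T (F n)) (path_class S T h)"
  unfolding is_sup_def
proof (intro conjI allI ballI impI)
  show "path_class S T h \<in> carrier ihom" using assms path_class_closed by blast
  show "path_class S T (F n) \<preceq>\<^bsub>ihom\<^esub> path_class S T h" for n
    using assms hom_leq_iff by (simp add: path_limit_def)
  fix u assume "u \<in> carrier ihom" and *: "\<forall>n. path_class S T (F n) \<preceq>\<^bsub>ihom\<^esub> u"
  then obtain g where g: "g \<in> cu_paths S T" "u = path_class S T g" using hom_carrierE by blast
  have Fg: "F n \<lesssim> g" for n using * hom_leq_iff[OF assms(1) g(1)] by (simp add: g(2))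
  have "h \<lesssim> g"
    unfolding path_lesssim_def
  proof
    fix m assume m: "m \<in> I_Q"
    obtain n l where l: "l \<in> I_Q" "h m \<prec> F n l" using assms(3) m by (auto simp: path_limit_def)
    obtain k where k: "k \<in> I_Q" "F n l \<prec> g k" using lesssimE[OF Fg l(1)] .
    have "h m \<prec> g k" by (rule path_prec_trans[OF assms(2,1) m l k(2)])
    then show "\<exists>k\<in>I_Q. h m \<prec> g k" using k(1) by blast
  qed
  then show "path_class S T h \<preceq>\<^bsub>ihom\<^esub> u" using assms(2) g by (simp add: hom_leq_iff)
qed

text \<open>Some limit \<open>h'\<close> exists and represents the supremum. Uniqueness of suprema
  makes \<open>h\<close> equivalent to \<open>h'\<close>, and being a limit is transported along the
  equivalence.\<close>

lemma hom_is_sup_iff: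
  assumes F: "\<And>n. F n \<in> cu_paths S T" "\<And>n. F n \<lesssim> F (Suc n)" and h: "h \<in> cu_paths S T"
  shows "is_sup ihom (\<lambda>n. path_class S T (F n)) (path_class S T h) \<longleftrightarrow> path_limit F h"
proof
  assume sup: "is_sup ihom (\<lambda>n. path_class S T (F n)) (path_class S T h)"
  obtain h' where h': "h' \<in> cu_paths S T" "path_limit F h'"
    using path_limit_exists[of F] F by blast
  then have "path_class S T h = path_class S T h'"
    by (intro pos_ordered_semigroup.is_sup_unique[OF hom_pos_ordered_semigroup sup]
        path_limit_is_sup F(1))
  then have eq: "h \<lesssim> h'" "h' \<lesssim> h" using path_class_eq_iff[OF h h'(1)] by simp_all
  have "\<exists>n. \<exists>l\<in>I_Q. h m \<prec> F n l" if m: "m \<in> I_Q" for m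
  proof -
    obtain k where k: "k \<in> I_Q" "h m \<prec> h' k" using lesssimE[OF eq(1) m] .
    obtain n l where l: "l \<in> I_Q" "h' k \<prec> F n l" using h'(2) k(1) by (auto simp: path_limit_def)
    have "h m \<prec> F n l" by (rule path_prec_trans[OF h h'(1) m k l(2)])
    then show ?thesis using l(1) by blast
  qed
  moreover have "F n \<lesssim> h" for n
    using h'(2) lesssim_trans[OF F(1) h'(1) _ eq(2)] by (simp add: path_limit_def)
  ultimately show "path_limit F h" by (simp add: path_limit_def)
qed (rule path_limit_is_sup[OF F(1) h])

section \<open>Cut-downs: a path restricted to parameters below a cutoff, rescaled to all of
  \<open>I_Q\<close>\<close>

definition path_cut :: "(rat \<Rightarrow> 'a \<Rightarrow> 'b) \<Rightarrow> nat \<Rightarrow> rat \<Rightarrow> 'a \<Rightarrow> 'b" where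
  "path_cut f n = (\<lambda>l \<in> I_Q. f (cutoff n * l))"

lemma path_cut_closed: "f \<in> cu_paths S T \<Longrightarrow> path_cut f n \<in> cu_paths S T"
proof -
  assume f: "f \<in> cu_paths S T"
  have "cutoff n * l' < cutoff n * l" if "l' < l" for l' l
    using that cutoff_I_Q[of n] by (simp add: I_Q_def)
  then show ?thesis
    unfolding cu_paths_def path_cut_def
    by (auto simp: I_Q_mult cutoff_I_Q path_Cu[OF f] intro!: path_prec[OF f])
qed

lemma path_cut_prec:
  "\<lbrakk>f \<in> cu_paths S T; l \<in> I_Q\<rbrakk> \<Longrightarrow> path_cut f n l \<prec> f (cutoff n)"
  by (simp add: path_cut_def path_prec I_Q_mult I_Q_mult_less cutoff_I_Q)

lemma prec_path_cut:
  assumes "f \<in> cu_paths S T" "m \<in> I_Q" "m < cutoff n"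
  shows "\<exists>l\<in>I_Q. f m \<prec> path_cut f n l"
proof -
  have n: "cutoff n \<in> I_Q" by (rule cutoff_I_Q)
  have "m / cutoff n < 1" using assms n by (simp add: I_Q_def)
  \<comment> \<open>The rescaled parameter \<open>cutoff n * l\<close> then exceeds
    \<open>m\<close>.\<close>
  then obtain l where l: "m / cutoff n < l" "l < 1" using dense by blast
  have "0 < m / cutoff n" using assms n by (simp add: I_Q_def)
  with l have lI: "l \<in> I_Q" by (simp add: I_Q_def)
  moreover have "m < cutoff n * l" using l n by (simp add: I_Q_def field_simps)
  ultimately show ?thesis using assms n
    by (intro bexI[of _ l]) (simp_all add: path_cut_def path_prec I_Q_mult)
qed

lemma path_cut_chain: "f \<in> cu_paths S T \<Longrightarrow> path_cut f n \<lesssim> path_cut f (Suc n)"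
  unfolding path_lesssim_def
proof
  fix l assume f: "f \<in> cu_paths S T" and l: "l \<in> I_Q"
  obtain m where m: "m \<in> I_Q" "f (cutoff n) \<prec> path_cut f (Suc n) m"
    using prec_path_cut[OF f cutoff_I_Q cutoff_strict_mono] by blast
  have "path_cut f n l \<prec> path_cut f (Suc n) m"
    by (rule path_prec_trans[OF path_cut_closed[OF f] f l cutoff_I_Q path_cut_prec[OF f l] m(2)])
  then show "\<exists>m\<in>I_Q. path_cut f n l \<prec> path_cut f (Suc n) m" using m(1) by blast
qed

lemma path_limit_cut:
  assumes "f \<in> cu_paths S T"
  shows "path_limit (path_cut f) f"
  unfolding path_limit_def path_lesssim_def
  using path_cut_prec[OF assms] prec_path_cut[OF assms] cutoff_I_Q cutoff_cofinal by meson

text \<open>Forward, the definition is tested on the cut-downs of \<open>g\<close>: \<open>f\<close>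
  is below one of them, and \<open>path_cut g n\<close> lies entirely below
  \<open>g (cutoff n)\<close>. Backward, \<open>g m\<close> is dominated by a single
  \<open>F n l\<close> of any sequence whose supremum is above \<open>g\<close>, and this one bound
  serves all \<open>f j\<close>.\<close>

lemma hom_way_below_iff:
  assumes f: "f \<in> cu_paths S T" and g: "g \<in> cu_paths S T"
  shows "path_class S T f \<lless>\<^bsub>ihom\<^esub> path_class S T g \<longleftrightarrow> (\<exists>m\<in>I_Q. \<forall>l\<in>I_Q. f l \<prec> g m)"
proof
  assume wb: "path_class S T f \<lless>\<^bsub>ihom\<^esub> path_class S T g"
  have "increasing ihom (\<lambda>n. path_class S T (path_cut g n))"
    using g by (simp add: increasing_def path_class_closed path_cut_closed hom_leq_iff path_cut_chain)
  moreover have "is_sup ihom (\<lambda>n. path_class S T (path_cut g n)) (path_class S T g)"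
    by (intro path_limit_is_sup path_cut_closed path_limit_cut g)
  moreover have "path_class S T g \<preceq>\<^bsub>ihom\<^esub> path_class S T g"
    using g by (simp add: hom_leq_iff lesssim_refl)
  ultimately obtain n where "path_class S T f \<preceq>\<^bsub>ihom\<^esub> path_class S T (path_cut g n)"
    using wb unfolding way_below_def by meson
  then have fg: "f \<lesssim> path_cut g n" using f g by (simp add: hom_leq_iff path_cut_closed)
  have "f l \<prec> g (cutoff n)" if l: "l \<in> I_Q" for l
  proof -
    obtain m where m: "m \<in> I_Q" "f l \<prec> path_cut g n m" using lesssimE[OF fg l] .
    show ?thesis
      by (rule path_prec_trans[OF f path_cut_closed[OF g] l m path_cut_prec[OF g m(1)]])
  qed
  then show "\<exists>m\<in>I_Q. \<forall>l\<in>I_Q. f l \<prec> g m" using cutoff_I_Q by blast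
next
  assume "\<exists>m\<in>I_Q. \<forall>l\<in>I_Q. f l \<prec> g m"
  then obtain m where m: "m \<in> I_Q" "\<And>l. l \<in> I_Q \<Longrightarrow> f l \<prec> g m" by blast
  show "path_class S T f \<lless>\<^bsub>ihom\<^esub> path_class S T g"
    unfolding way_below_def
  proof (intro allI impI, elim conjE)
    fix c s assume c: "increasing ihom c" and s: "is_sup ihom c s"
      and gs: "path_class S T g \<preceq>\<^bsub>ihom\<^esub> s"
    obtain F where F: "\<And>n. F n \<in> cu_paths S T" "\<And>n. c n = path_class S T (F n)"
      "\<And>n. F n \<lesssim> F (Suc n)"
      using hom_increasingE[OF c] by blast
    obtain h where h: "h \<in> cu_paths S T" "s = path_class S T h"
      using s hom_carrierE by (metis is_sup_def)
    have "c = (\<lambda>n. path_class S T (F n))" using F(2) by blast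
    then have lim: "path_limit F h" using s hom_is_sup_iff[of F h] F h by simp
    have "g \<lesssim> h" using gs g h by (simp add: hom_leq_iff)
    then obtain k where k: "k \<in> I_Q" "g m \<prec> h k" using lesssimE m(1) by blast
    obtain n l where l: "l \<in> I_Q" "h k \<prec> F n l" using lim k(1) unfolding path_limit_def by blast
    have "f j \<prec> F n l" if j: "j \<in> I_Q" for j
      by (rule path_prec_trans[OF f g j m(1) m(2)[OF j] path_prec_trans[OF g h(1) m(1) k l(2)]])
    then have "f \<lesssim> F n" using l(1) unfolding path_lesssim_def by blast
    then have "path_class S T f \<preceq>\<^bsub>ihom\<^esub> c n" using f F(1,2) by (simp add: hom_leq_iff)
    then show "\<exists>n. path_class S T f \<preceq>\<^bsub>ihom\<^esub> c n" ..
  qed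
qed

section \<open>Sums of limits and the axioms (O1) to (O4)\<close>

lemma path_limit_add:
  assumes F: "\<And>n. F n \<in> cu_paths S T" "\<And>n. F n \<lesssim> F (Suc n)"
    and G: "\<And>n. G n \<in> cu_paths S T" "\<And>n. G n \<lesssim> G (Suc n)"
    and h: "h \<in> cu_paths S T" "path_limit F h" and k: "k \<in> cu_paths S T" "path_limit G k"
  shows "path_limit (\<lambda>n. path_add S T (F n) (G n)) (path_add S T h k)"
  unfolding path_limit_def
proof (intro conjI allI ballI)
  show "path_add S T (F n) (G n) \<lesssim> path_add S T h k" for n
    using assms by (simp add: path_limit_def path_add_lesssim)
  fix m assume m: "m \<in> I_Q"
  obtain i l where l: "l \<in> I_Q" "h m \<prec> F i l" using h(2) m unfolding path_limit_def by blast
  obtain j l' where l': "l' \<in> I_Q" "k m \<prec> G j l'" using k(2) m unfolding path_limit_def by blast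
  \<comment> \<open>The two limits are dominated at different stages \<open>i\<close> and
    \<open>j\<close>; both sequences are moved to a common stage, and then the parameters to a
    common \<open>q\<close>.\<close>
  define n where "n = max i j"
  have "F i \<lesssim> F n" "G j \<lesssim> G n"
    using path_lesssim_chain[of F i n] path_lesssim_chain[of G j n] F G by (simp_all add: n_def)
  then obtain p p' where p: "p \<in> I_Q" "F i l \<prec> F n p" and p': "p' \<in> I_Q" "G j l' \<prec> G n p'"
    using l(1) l'(1) by (meson lesssimE)
  obtain q where q: "q \<in> I_Q" "p < q" "p' < q" using I_Q_dense[OF p(1) p'(1)] .
  have "h m \<prec> F n p" by (rule path_prec_trans[OF h(1) F(1) m l p(2)])
  moreover have "k m \<prec> G n p'" by (rule path_prec_trans[OF k(1) G(1) m l' p'(2)])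
  ultimately have "path_add S T h k m \<prec> path_add S T (F n) (G n) q"
    by (rule path_add_prec[OF h(1) k(1) F(1) G(1) m p(1) q(1) p'(1) q(2,3)])
  then show "\<exists>n. \<exists>l\<in>I_Q. path_add S T h k m \<prec> path_add S T (F n) (G n) l" using q by blast
qed

text \<open>(O1) is the existence of limits, (O2) is approximation by cut-downs, (O3) adds the
  bounds from \<open>hom_way_below_iff\<close>, and (O4) is additivity of limits.\<close>

lemma hom_cu_semigroup: "cu_semigroup ihom"
proof (intro cu_semigroup.intro hom_pos_ordered_semigroup cu_semigroup_axioms.intro)
  fix c assume "increasing ihom c"
  then obtain F where F: "\<And>n. F n \<in> cu_paths S T" "\<And>n. c n = path_class S T (F n)"
    "\<And>n. F n \<lesssim> F (Suc n)"
    using hom_increasingE by blast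
  then obtain h where "h \<in> cu_paths S T" "path_limit F h"
    using path_limit_exists[of F] by blast
  then have "is_sup ihom (\<lambda>n. path_class S T (F n)) (path_class S T h)"
    using F(1) by (intro path_limit_is_sup)
  moreover have "c = (\<lambda>n. path_class S T (F n))" using F by blast
  ultimately show "\<exists>s. is_sup ihom c s" by metis
next
  fix a assume "a \<in> carrier ihom"
  then obtain f where f: "f \<in> cu_paths S T" "a = path_class S T f" using hom_carrierE by blast
  have "path_class S T (path_cut f n) \<lless>\<^bsub>ihom\<^esub> path_class S T (path_cut f (Suc n))" for n
  proof -
    \<comment> \<open>The morphism \<open>f (cutoff n)\<close> separates the two cut-downs: it
      dominates every \<open>path_cut f n l\<close>, so the same \<open>m\<close> works for all
      \<open>l\<close>.\<close>
    obtain m where m: "m \<in> I_Q" "f (cutoff n) \<prec> path_cut f (Suc n) m"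
      using prec_path_cut[OF f(1) cutoff_I_Q cutoff_strict_mono] by blast
    have "path_cut f n l \<prec> path_cut f (Suc n) m" if l: "l \<in> I_Q" for l
      by (rule path_prec_trans[OF path_cut_closed[OF f(1)] f(1) l cutoff_I_Q
            path_cut_prec[OF f(1) l] m(2)])
    then show ?thesis using m(1) f(1) by (auto simp: hom_way_below_iff path_cut_closed)
  qed
  moreover have "is_sup ihom (\<lambda>n. path_class S T (path_cut f n)) a"
    unfolding f(2) by (intro path_limit_is_sup path_cut_closed path_limit_cut f(1))
  ultimately show "\<exists>c. (\<forall>n. c n \<in> carrier ihom) \<and> (\<forall>n. c n \<lless>\<^bsub>ihom\<^esub> c (Suc n)) \<and> is_sup ihom c a"
    using f path_class_closed path_cut_closed
    by (intro exI[of _ "\<lambda>n. path_class S T (path_cut f n)"]) blast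
next
  fix a' a b' b
  assume cl: "a' \<in> carrier ihom" "a \<in> carrier ihom" "b' \<in> carrier ihom" "b \<in> carrier ihom"
    and wb: "a' \<lless>\<^bsub>ihom\<^esub> a" "b' \<lless>\<^bsub>ihom\<^esub> b"
  obtain f' f where f: "f' \<in> cu_paths S T" "f \<in> cu_paths S T"
      "a' = path_class S T f'" "a = path_class S T f"
    using cl(1,2) by (elim hom_carrierE)
  obtain g' g where g: "g' \<in> cu_paths S T" "g \<in> cu_paths S T"
      "b' = path_class S T g'" "b = path_class S T g"
    using cl(3,4) by (elim hom_carrierE)
  note p = f(1,2) g(1,2) and eq = f(3,4) g(3,4)
  obtain m where m: "m \<in> I_Q" "\<And>l. l \<in> I_Q \<Longrightarrow> f' l \<prec> f m"
    using wb(1) p by (auto simp: eq hom_way_below_iff)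
  obtain k where k: "k \<in> I_Q" "\<And>l. l \<in> I_Q \<Longrightarrow> g' l \<prec> g k"
    using wb(2) p by (auto simp: eq hom_way_below_iff)
  obtain q where q: "q \<in> I_Q" "m < q" "k < q" using I_Q_dense[OF m(1) k(1)] .
  have "path_add S T f' g' l \<prec> path_add S T f g q" if "l \<in> I_Q" for l
    by (rule path_add_prec[OF p(1,3,2,4) that m(1) q(1) k(1) q(2,3) m(2)[OF that] k(2)[OF that]])
  then show "a' \<oplus>\<^bsub>ihom\<^esub> b' \<lless>\<^bsub>ihom\<^esub> a \<oplus>\<^bsub>ihom\<^esub> b"
    using p q by (auto simp: eq hom_add hom_way_below_iff path_add_closed)
next
  fix c d s t
  assume cd: "increasing ihom c" "increasing ihom d" and st: "is_sup ihom c s" "is_sup ihom d t"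
  obtain F where F: "\<And>n. F n \<in> cu_paths S T" "\<And>n. c n = path_class S T (F n)"
    "\<And>n. F n \<lesssim> F (Suc n)"
    using hom_increasingE[OF cd(1)] by blast
  obtain G where G: "\<And>n. G n \<in> cu_paths S T" "\<And>n. d n = path_class S T (G n)"
    "\<And>n. G n \<lesssim> G (Suc n)"
    using hom_increasingE[OF cd(2)] by blast
  obtain h k where h: "h \<in> cu_paths S T" "s = path_class S T h"
    and k: "k \<in> cu_paths S T" "t = path_class S T k"
    using st hom_carrierE by (metis is_sup_def)
  have c: "c = (\<lambda>n. path_class S T (F n))" and d: "d = (\<lambda>n. path_class S T (G n))"
    using F G by blast+
  have "path_limit F h" "path_limit G k"
    using st hom_is_sup_iff[of F h] hom_is_sup_iff[of G k] F(1,3) G(1,3) h k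
    by (simp_all add: c d)
  then have "path_limit (\<lambda>n. path_add S T (F n) (G n)) (path_add S T h k)"
    using path_limit_add[of F G h k] F G h k by simp
  then show "is_sup ihom (\<lambda>n. c n \<oplus>\<^bsub>ihom\<^esub> d n) (s \<oplus>\<^bsub>ihom\<^esub> t)"
    using F(1) G(1) h k path_limit_is_sup[of "\<lambda>n. path_add S T (F n) (G n)"]
    by (simp add: c d hom_add path_add_closed)
qed

end

section \<open>Ideals and the inclusion map\<close>

context cu_ideal
begin

abbreviation J_structure where "J_structure \<equiv> S\<lparr>carrier := J\<rparr>"

lemma increasing_ideal_iff: "increasing J_structure c \<longleftrightarrow> increasing S c \<and> (\<forall>n. c n \<in> J)"
  using subset by (auto simp: increasing_def)

text \<open>The supremum in \<open>S\<close> lies in \<open>J\<close> because \<open>J\<close> is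
  closed under suprema, hence it is also the supremum in \<open>J\<close>; antisymmetry identifies
  any other one with it.\<close>

lemma is_sup_ideal_iff:
  assumes c: "increasing J_structure c"
  shows "is_sup J_structure c s \<longleftrightarrow> is_sup S c s"
proof
  have c': "increasing S c" "\<And>n. c n \<in> J" using c by (auto simp: increasing_ideal_iff)
  {
    fix t assume t: "is_sup S c t"
    then have "t \<in> J" by (rule sup_closed[OF c'])
    with t subset show "is_sup J_structure c t" by (auto simp: is_sup_def)
  } note sup = this
  assume s: "is_sup J_structure c s"
  obtain t where t: "is_sup S c t" using O1 c' by blast
  have "s \<preceq> t" "t \<preceq> s" "s \<in> J" "t \<in> J" using s sup[OF t] by (auto simp: is_sup_def)
  then have "s = t" using leq_antisym[of s t] subset by blast
  with t show "is_sup S c s" by simp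
qed

text \<open>From \<open>J\<close> to \<open>S\<close>, heredity is essential: an (O2) sequence for
  \<open>b\<close> taken in \<open>S\<close> lies below \<open>b\<close>, hence in \<open>J\<close>,
  where the hypothesis places \<open>a\<close> below some \<open>c k \<lless> b\<close>. Conversely,
  test sequences in \<open>J\<close> are test sequences in \<open>S\<close> with the same
  suprema.\<close>

lemma way_below_ideal_iff:
  assumes a: "a \<in> J" and b: "b \<in> J"
  shows "a \<lless>\<^bsub>J_structure\<^esub> b \<longleftrightarrow> a \<lless> b"
proof
  assume wb: "a \<lless>\<^bsub>J_structure\<^esub> b"
  have bS: "b \<in> carrier S" using b subset by blast
  obtain c where c: "increasing S c" "\<And>n. c n \<in> carrier S" "\<And>n. c n \<lless> b"
      "\<And>n. c n \<preceq> b" "is_sup S c b"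
    using way_below_sequenceE[OF bS] by metis
  have "c n \<in> J" for n using hereditary[OF c(2) b c(4)] .
  then have inc: "increasing J_structure c" using c(1) by (simp add: increasing_ideal_iff)
  then have "is_sup J_structure c b" using c(5) is_sup_ideal_iff by blast
  with inc wb obtain k where k: "a \<preceq> c k"
    using leq_refl[OF bS] by (auto simp: way_below_def)
  show "a \<lless> b" using leq_way_below_trans[OF _ c(2) k c(3)] a subset by blast
next
  assume wb: "a \<lless> b"
  show "a \<lless>\<^bsub>J_structure\<^esub> b"
    unfolding way_below_def
  proof (intro allI impI, elim conjE)
    fix c s assume "increasing J_structure c" "is_sup J_structure c s" "b \<preceq>\<^bsub>J_structure\<^esub> s"
    then show "\<exists>k. a \<preceq>\<^bsub>J_structure\<^esub> c k"
      using wb by (auto simp: way_below_def is_sup_ideal_iff increasing_ideal_iff)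
  qed
qed

lemma ideal_pos_ordered_semigroup: "pos_ordered_semigroup J_structure"
proof (intro pos_ordered_semigroup.intro pos_ordered_semigroup_axioms.intro)
  show "comm_monoid J_structure"
    by (rule comm_monoidI) (use subset m_assoc m_comm in auto)
  show "a \<preceq>\<^bsub>J_structure\<^esub> c"
    if "a \<in> carrier J_structure" "b \<in> carrier J_structure" "c \<in> carrier J_structure"
      "a \<preceq>\<^bsub>J_structure\<^esub> b" "b \<preceq>\<^bsub>J_structure\<^esub> c" for a b c
    using that subset leq_trans[of a b c] by auto
qed (use subset leq_refl leq_antisym add_mono zero_leq in auto)

lemma ideal_cu_semigroup: "cu_semigroup J_structure"
proof (intro cu_semigroup.intro ideal_pos_ordered_semigroup cu_semigroup_axioms.intro)
  fix c assume "increasing J_structure c"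
  then show "\<exists>s. is_sup J_structure c s"
    using O1[of c] is_sup_ideal_iff[of c] by (simp add: increasing_ideal_iff)
next
  fix a assume "a \<in> carrier J_structure"
  then have aJ: "a \<in> J" and a: "a \<in> carrier S" using subset by auto
  obtain c where c: "increasing S c" "\<And>n. c n \<in> carrier S" "\<And>n. c n \<lless> c (Suc n)"
      "\<And>n. c n \<preceq> a" "is_sup S c a"
    using way_below_sequenceE[OF a] by metis
  have cJ: "c n \<in> J" for n using hereditary[OF c(2) aJ c(4)] .
  with c(1,5) have "is_sup J_structure c a" by (simp add: is_sup_ideal_iff increasing_ideal_iff)
  then show "\<exists>c. (\<forall>n. c n \<in> carrier J_structure) \<and>
      (\<forall>n. c n \<lless>\<^bsub>J_structure\<^esub> c (Suc n)) \<and> is_sup J_structure c a"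
    using c(3) cJ by (intro exI[of _ c]) (simp add: way_below_ideal_iff)
next
  fix a' a b' b
  assume "a' \<in> carrier J_structure" "a \<in> carrier J_structure"
    "b' \<in> carrier J_structure" "b \<in> carrier J_structure"
    and wb: "a' \<lless>\<^bsub>J_structure\<^esub> a" "b' \<lless>\<^bsub>J_structure\<^esub> b"
  then have J: "a' \<in> J" "a \<in> J" "b' \<in> J" "b \<in> J" by simp_all
  then have S: "a' \<in> carrier S" "a \<in> carrier S" "b' \<in> carrier S" "b \<in> carrier S"
    using subset by auto
  have "a' \<lless> a" "b' \<lless> b" using wb J by (simp_all add: way_below_ideal_iff)
  then have "a' \<oplus> b' \<lless> a \<oplus> b" by (rule O3[OF S])
  then show "a' \<oplus>\<^bsub>J_structure\<^esub> b' \<lless>\<^bsub>J_structure\<^esub> a \<oplus>\<^bsub>J_structure\<^esub> b"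
    using J by (simp add: way_below_ideal_iff m_closed)
next
  fix c d s t
  assume inc: "increasing J_structure c" "increasing J_structure d"
    and sup: "is_sup J_structure c s" "is_sup J_structure d t"
  have J: "s \<in> J" "t \<in> J" "\<And>n. c n \<in> J" "\<And>n. d n \<in> J"
    using inc sup by (auto simp: is_sup_def increasing_def)
  have "is_sup S (\<lambda>n. c n \<oplus> d n) (s \<oplus> t)"
    using O4[of c d s t] inc sup by (simp add: is_sup_ideal_iff increasing_ideal_iff)
  then show "is_sup J_structure (\<lambda>n. c n \<oplus>\<^bsub>J_structure\<^esub> d n) (s \<oplus>\<^bsub>J_structure\<^esub> t)"
    using J subset by (auto simp: is_sup_def m_closed)
qed

end

section \<open>Morphisms and paths with values in an ideal\<close>

locale cu_ideal_pair = S: cu_semigroup S + T: cu_ideal J T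
  for S :: "('a, 'm) ordered_monoid_scheme" and J
    and T :: "('b, 'n) ordered_monoid_scheme"
begin

abbreviation TJ where "TJ \<equiv> T\<lparr>carrier := J\<rparr>"

interpretation cu_pair S T by unfold_locales

interpretation J: cu_pair S TJ
  by (rule cu_pair.intro[OF S.cu_semigroup_axioms T.ideal_cu_semigroup])

text \<open>Addition, zero and order are inherited, and suprema of increasing sequences agree in
  \<open>J\<close> and \<open>T\<close>, so the location of the values is the only
  difference.\<close>

lemma Cu_ideal_iff: "f \<in> Cu S TJ \<longleftrightarrow> f \<in> Cu S T \<and> f ` carrier S \<subseteq> J"
proof
  assume f: "f \<in> Cu S TJ"
  then interpret f: generalized_cu_morphism S TJ f by (simp add: J.Cu_iff)
  have fJ: "f a \<in> J" if "a \<in> carrier S" for a using J.Cu_closed[OF f that] by simp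
  have "generalized_cu_morphism S T f"
  proof unfold_locales
    show "f \<in> carrier S \<rightarrow>\<^sub>E carrier T" using f.maps T.subset by (auto simp: PiE_iff)
    show "is_sup T (\<lambda>n. f (c n)) (f s)" if "increasing S c" "is_sup S c s" for c s
      using f.map_sup[OF that] T.is_sup_ideal_iff[OF J.Cu_increasing[OF f that(1)]] by blast
  qed (use f.map_add f.map_zero f.map_leq in auto)
  then show "f \<in> Cu S T \<and> f ` carrier S \<subseteq> J" using fJ by (auto simp: Cu_iff)
next
  assume f: "f \<in> Cu S T \<and> f ` carrier S \<subseteq> J"
  then interpret f: generalized_cu_morphism S T f by (simp add: Cu_iff)
  have "generalized_cu_morphism S TJ f"
  proof unfold_locales
    show "f \<in> carrier S \<rightarrow>\<^sub>E carrier TJ" using f f.maps by (auto simp: PiE_iff)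
    fix c s assume c: "increasing S c" "is_sup S c s"
    have "\<And>n. c n \<in> carrier S" using c(1) by (simp add: increasing_def)
    then have "increasing TJ (\<lambda>n. f (c n))"
      using f Cu_increasing[of f c] c(1) by (auto simp: T.increasing_ideal_iff)
    then show "is_sup TJ (\<lambda>n. f (c n)) (f s)"
      using f.map_sup[OF c] T.is_sup_ideal_iff by blast
  qed (use f.map_add f.map_zero f.map_leq in auto)
  then show "f \<in> Cu S TJ" by (simp add: J.Cu_iff)
qed

lemma precedes_ideal_iff:
  assumes "\<phi> ` carrier S \<subseteq> J" "\<psi> ` carrier S \<subseteq> J"
  shows "precedes S TJ \<phi> \<psi> \<longleftrightarrow> precedes S T \<phi> \<psi>"
proof -
  have "\<phi> a \<in> J" "\<psi> a \<in> J" if "a \<in> carrier S" for a using that assms by auto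
  then show ?thesis by (simp add: precedes_def T.way_below_ideal_iff)
qed

lemma precedes_imp_image_ideal:
  assumes \<phi>: "\<phi> \<in> Cu S T" and \<psi>: "\<psi> \<in> Cu S T" "\<psi> ` carrier S \<subseteq> J" and "precedes S T \<phi> \<psi>"
  shows "\<phi> ` carrier S \<subseteq> J"
proof safe
  fix a assume a: "a \<in> carrier S"
  have "\<phi> a \<preceq>\<^bsub>T\<^esub> \<psi> a" by (rule prec_imp_leq[OF \<phi> \<psi>(1) assms(4) a])
  moreover have "\<psi> a \<in> J" using a \<psi>(2) by blast
  ultimately show "\<phi> a \<in> J" using T.hereditary[OF Cu_closed[OF \<phi> a]] by blast
qed

lemma cu_paths_ideal_iff:
  "f \<in> cu_paths S TJ \<longleftrightarrow> f \<in> cu_paths S T \<and> (\<forall>l \<in> I_Q. f l ` carrier S \<subseteq> J)"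
proof -
  have "f \<in> I_Q \<rightarrow>\<^sub>E Cu S TJ \<longleftrightarrow> f \<in> I_Q \<rightarrow>\<^sub>E Cu S T \<and> (\<forall>l \<in> I_Q. f l ` carrier S \<subseteq> J)"
    by (auto simp: PiE_iff Cu_ideal_iff)
  then show ?thesis by (auto simp: cu_paths_def precedes_ideal_iff)
qed

lemma path_lesssim_ideal_iff:
  assumes "f \<in> cu_paths S TJ" "g \<in> cu_paths S TJ"
  shows "path_lesssim S TJ f g \<longleftrightarrow> path_lesssim S T f g"
  using assms by (auto simp: path_lesssim_def cu_paths_ideal_iff precedes_ideal_iff)

lemma path_lesssim_imp_ideal:
  assumes f: "f \<in> cu_paths S T" and g: "g \<in> cu_paths S TJ" and "path_lesssim S T f g"
  shows "f \<in> cu_paths S TJ"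
proof -
  have "f l ` carrier S \<subseteq> J" if l: "l \<in> I_Q" for l
  proof -
    obtain m where m: "m \<in> I_Q" "precedes S T (f l) (g m)" using lesssimE[OF assms(3) l] .
    then show ?thesis
      using g f l precedes_imp_image_ideal[of "f l" "g m"] path_Cu by (simp add: cu_paths_ideal_iff)
  qed
  with f show ?thesis by (simp add: cu_paths_ideal_iff)
qed

text \<open>Passing from \<open>J\<close> to \<open>T\<close> could only add representatives; but a
  path equivalent to \<open>f\<close> is below \<open>f\<close>, which confines its values to
  \<open>J\<close>.\<close>

lemma path_class_ideal:
  assumes f: "f \<in> cu_paths S TJ"
  shows "path_class S TJ f = path_class S T f"
proof -
  have fT: "f \<in> cu_paths S T" using f by (simp add: cu_paths_ideal_iff)
  have "g \<in> path_class S TJ f \<longleftrightarrow> g \<in> path_class S T f" for g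
  proof (cases "g \<in> cu_paths S TJ")
    case True
    then show ?thesis using f fT
      by (simp add: J.mem_path_class_iff mem_path_class_iff path_lesssim_ideal_iff cu_paths_ideal_iff)
  next
    case False
    then show ?thesis using path_lesssim_imp_ideal[OF _ f, of g]
      by (auto simp: J.mem_path_class_iff mem_path_class_iff)
  qed
  then show ?thesis by blast
qed

section \<open>The internal hom into the ideal inside the internal hom into \<open>T\<close>\<close>

lemma hom_ideal_carrier_iff:
  "x \<in> carrier (internal_hom S TJ) \<longleftrightarrow> (\<exists>f \<in> cu_paths S TJ. x = path_class S T f)"
  by (auto simp: J.hom_carrier_iff path_class_ideal)

lemma hom_ideal_subset: "carrier (internal_hom S TJ) \<subseteq> carrier (internal_hom S T)"
proof
  fix x assume "x \<in> carrier (internal_hom S TJ)"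
  then obtain f where f: "f \<in> cu_paths S TJ" "x = path_class S T f"
    by (auto simp: hom_ideal_carrier_iff)
  then have "f \<in> cu_paths S T" by (simp add: cu_paths_ideal_iff)
  then show "x \<in> carrier (internal_hom S T)" unfolding f(2) by (rule path_class_closed)
qed

text \<open>This is the independence of the representative behind "some" and "every" in the theorem:
  a path sharing its class with a path in \<open>J\<close> is below it, hence takes values in
  \<open>J\<close> too.\<close>

lemma path_class_in_hom_ideal_iff:
  assumes f: "f \<in> cu_paths S T"
  shows "path_class S T f \<in> carrier (internal_hom S TJ) \<longleftrightarrow> f \<in> cu_paths S TJ"
proof
  assume "path_class S T f \<in> carrier (internal_hom S TJ)"
  then obtain g where g: "g \<in> cu_paths S TJ" "path_class S T f = path_class S T g"
    by (auto simp: hom_ideal_carrier_iff)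
  then have "path_lesssim S T f g"
    using path_class_eq_iff[OF f, of g] by (simp add: cu_paths_ideal_iff)
  then show "f \<in> cu_paths S TJ" by (rule path_lesssim_imp_ideal[OF f g(1)])
next
  assume "f \<in> cu_paths S TJ"
  then show "path_class S T f \<in> carrier (internal_hom S TJ)"
    unfolding hom_ideal_carrier_iff by blast
qed

lemma hom_ideal_add:
  assumes "x \<in> carrier (internal_hom S TJ)" "y \<in> carrier (internal_hom S TJ)"
  shows "x \<oplus>\<^bsub>internal_hom S TJ\<^esub> y = x \<oplus>\<^bsub>internal_hom S T\<^esub> y"
proof -
  obtain f g where f: "f \<in> cu_paths S TJ" "x = path_class S T f"
    and g: "g \<in> cu_paths S TJ" "y = path_class S T g"
    using assms by (auto simp: hom_ideal_carrier_iff)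
  have "path_add S TJ f g = path_add S T f g" by (simp add: path_add_def)
  moreover have "path_add S TJ f g \<in> cu_paths S TJ" using f g J.path_add_closed by blast
  ultimately show ?thesis
    using f g J.hom_add[of f g] hom_add[of f g] by (simp add: path_class_ideal cu_paths_ideal_iff)
qed

lemma hom_ideal_zero: "\<zero>\<^bsub>internal_hom S TJ\<^esub> = \<zero>\<^bsub>internal_hom S T\<^esub>"
  using path_class_ideal[OF J.path_zero_closed] by (simp add: J.hom_zero hom_zero)

lemma hom_ideal_leq_iff:
  assumes "x \<in> carrier (internal_hom S TJ)" "y \<in> carrier (internal_hom S TJ)"
  shows "x \<preceq>\<^bsub>internal_hom S TJ\<^esub> y \<longleftrightarrow> x \<preceq>\<^bsub>internal_hom S T\<^esub> y"
proof -
  obtain f g where f: "f \<in> cu_paths S TJ" "x = path_class S T f"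
    and g: "g \<in> cu_paths S TJ" "y = path_class S T g"
    using assms by (auto simp: hom_ideal_carrier_iff)
  then show ?thesis
    using J.hom_leq_iff[of f g] hom_leq_iff[of f g]
    by (simp add: path_class_ideal path_lesssim_ideal_iff cu_paths_ideal_iff)
qed

text \<open>For suprema, a limit \<open>h\<close> has each \<open>h m\<close> dominated by some
  \<open>F n l\<close> with values in \<open>J\<close>, so \<open>h\<close> takes values in
  \<open>J\<close>. Heredity is the same argument for a single path.\<close>

lemma hom_cu_ideal: "cu_ideal (carrier (internal_hom S TJ)) (internal_hom S T)"
proof (intro cu_ideal.intro hom_cu_semigroup submonoid.intro cu_ideal_axioms.intro)
  interpret H: cu_semigroup "internal_hom S TJ" by (rule J.hom_cu_semigroup)
  show "carrier (internal_hom S TJ) \<subseteq> carrier (internal_hom S T)" by (rule hom_ideal_subset)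
  show "x \<oplus>\<^bsub>internal_hom S T\<^esub> y \<in> carrier (internal_hom S TJ)"
    if "x \<in> carrier (internal_hom S TJ)" "y \<in> carrier (internal_hom S TJ)" for x y
    using H.m_closed[OF that] hom_ideal_add[OF that] by simp
  show "\<zero>\<^bsub>internal_hom S T\<^esub> \<in> carrier (internal_hom S TJ)"
    using H.one_closed by (simp add: hom_ideal_zero)
next
  fix c s assume c: "increasing (internal_hom S T) c" "\<And>n. c n \<in> carrier (internal_hom S TJ)"
    and s: "is_sup (internal_hom S T) c s"
  obtain F where F: "\<And>n. F n \<in> cu_paths S T" "\<And>n. c n = path_class S T (F n)"
    "\<And>n. path_lesssim S T (F n) (F (Suc n))"
    using hom_increasingE[OF c(1)] by blast
  have FJ: "F n \<in> cu_paths S TJ" for n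
    using c(2)[of n] path_class_in_hom_ideal_iff[OF F(1)] by (simp add: F(2))
  have "s \<in> carrier (internal_hom S T)" using s by (simp add: is_sup_def)
  then obtain h where h: "h \<in> cu_paths S T" "s = path_class S T h" by (rule hom_carrierE)
  have ceq: "c = (\<lambda>n. path_class S T (F n))" using F(2) by blast
  have lim: "path_limit F h" using s hom_is_sup_iff[of F h] F(1,3) h by (simp add: ceq)
  have "h m ` carrier S \<subseteq> J" if m: "m \<in> I_Q" for m
  proof -
    obtain n l where l: "l \<in> I_Q" "precedes S T (h m) (F n l)"
      using lim m by (auto simp: path_limit_def)
    show ?thesis
      by (rule precedes_imp_image_ideal[OF path_Cu[OF h(1) m] path_Cu[OF F(1) l(1)] _ l(2)])
        (use FJ[of n] l(1) in \<open>simp add: cu_paths_ideal_iff\<close>)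
  qed
  then show "s \<in> carrier (internal_hom S TJ)"
    using h path_class_in_hom_ideal_iff[of h] by (simp add: cu_paths_ideal_iff)
next
  fix a b assume a: "a \<in> carrier (internal_hom S T)" and b: "b \<in> carrier (internal_hom S TJ)"
    and leq: "a \<preceq>\<^bsub>internal_hom S T\<^esub> b"
  obtain f where f: "f \<in> cu_paths S T" "a = path_class S T f" using a by (rule hom_carrierE)
  obtain g where g: "g \<in> cu_paths S TJ" "b = path_class S T g"
    using b by (auto simp: hom_ideal_carrier_iff)
  have "path_lesssim S T f g" using leq f g hom_leq_iff[of f g] by (simp add: cu_paths_ideal_iff)
  then show "a \<in> carrier (internal_hom S TJ)"
    using path_lesssim_imp_ideal[OF f(1) g(1)] f path_class_in_hom_ideal_iff by simp
qed

section \<open>The map induced by the inclusion\<close>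

lemma internal_hom_map_inclusion:
  assumes x: "x \<in> carrier (internal_hom S TJ)"
  shows "internal_hom_map S TJ T (\<lambda>y \<in> J. y) x = x"
proof -
  obtain f where f: "f \<in> cu_paths S TJ" "x = path_class S TJ f"
    using x by (rule J.hom_carrierE)
  \<comment> \<open>Composition with the restricted identity changes no value, and extensionality
    turns this into equality of paths.\<close>
  have eq: "(\<lambda>l \<in> I_Q. compose (carrier S) (\<lambda>y \<in> J. y) (g l)) = g" if g: "g \<in> cu_paths S TJ" for g
  proof (rule extensionalityI[of _ I_Q])
    show "g \<in> extensional I_Q" using g by (simp add: cu_paths_def PiE_def)
    fix l assume l: "l \<in> I_Q"
    have "compose (carrier S) (\<lambda>y \<in> J. y) (g l) = g l"
    proof (rule extensionalityI[of _ "carrier S"])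
      show "g l \<in> extensional (carrier S)" using J.Cu_extensional J.path_Cu[OF g l] by blast
      show "compose (carrier S) (\<lambda>y \<in> J. y) (g l) a = g l a" if "a \<in> carrier S" for a
        using J.Cu_closed[OF J.path_Cu[OF g l] that] that by (simp add: compose_def)
    qed simp
    then show "(\<lambda>l \<in> I_Q. compose (carrier S) (\<lambda>y \<in> J. y) (g l)) l = g l" using l by simp
  qed simp
  have "path_class S T (\<lambda>l \<in> I_Q. compose (carrier S) (\<lambda>y \<in> J. y) (g l)) = x" if "g \<in> x" for g
  proof -
    have g: "g \<in> cu_paths S TJ" "path_lesssim S TJ f g" "path_lesssim S TJ g f"
      using that by (simp_all add: f(2) J.mem_path_class_iff)
    then have "path_class S TJ g = x" using J.path_class_eq_iff[OF g(1) f(1)] by (simp add: f(2))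
    then show ?thesis using g(1) by (simp add: eq path_class_ideal)
  qed
  moreover have "f \<in> x" using f J.lesssim_refl by (simp add: J.mem_path_class_iff)
  ultimately have "(\<Union>g \<in> x. path_class S T (\<lambda>l \<in> I_Q. compose (carrier S) (\<lambda>y \<in> J. y) (g l))) = x"
    by blast
  then show ?thesis using x by (simp add: internal_hom_map_def)
qed

lemma internal_hom_map_inclusion_image:
  "internal_hom_map S TJ T (\<lambda>y \<in> J. y) ` carrier (internal_hom S TJ) = carrier (internal_hom S TJ)"
  by (simp add: internal_hom_map_inclusion)

lemma internal_hom_map_inclusion_embedding:
  "order_embedding (internal_hom S TJ) (internal_hom S T) (internal_hom_map S TJ T (\<lambda>y \<in> J. y))"
  using hom_ideal_subset
  by (auto simp: order_embedding_def internal_hom_map_inclusion hom_ideal_leq_iff)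

text \<open>Way-below and suprema are both described by \<open>\<prec>\<close> between members of
  paths, and this relation is the same over \<open>J\<close> and over \<open>T\<close>; so the same
  parameter \<open>m\<close> and the same limit \<open>h\<close> serve on both sides.\<close>

lemma internal_hom_map_inclusion_cu_morphism:
  "cu_morphism (internal_hom S TJ) (internal_hom S T) (internal_hom_map S TJ T (\<lambda>y \<in> J. y))"
    (is "cu_morphism ?SJ ?ST ?\<iota>")
proof (intro cu_morphism.intro generalized_cu_morphism.intro generalized_cu_morphism_axioms.intro
    cu_morphism_axioms.intro J.hom_cu_semigroup hom_cu_semigroup)
  interpret H: cu_semigroup ?SJ by (rule J.hom_cu_semigroup)
  note \<iota> = internal_hom_map_inclusion
  show "?\<iota> \<in> carrier ?SJ \<rightarrow>\<^sub>E carrier ?ST"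
    using hom_ideal_subset by (auto simp: PiE_iff \<iota>) (simp add: internal_hom_map_def)
  show "?\<iota> (a \<oplus>\<^bsub>?SJ\<^esub> b) = ?\<iota> a \<oplus>\<^bsub>?ST\<^esub> ?\<iota> b" if "a \<in> carrier ?SJ" "b \<in> carrier ?SJ" for a b
    using that H.m_closed[OF that] hom_ideal_add[OF that] by (simp add: \<iota>)
  show "?\<iota> \<zero>\<^bsub>?SJ\<^esub> = \<zero>\<^bsub>?ST\<^esub>" using \<iota>[OF H.one_closed] hom_ideal_zero by simp
  show "?\<iota> a \<preceq>\<^bsub>?ST\<^esub> ?\<iota> b" if "a \<in> carrier ?SJ" "b \<in> carrier ?SJ" "a \<preceq>\<^bsub>?SJ\<^esub> b" for a b
    using that by (simp add: \<iota> hom_ideal_leq_iff)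
  show "?\<iota> a \<lless>\<^bsub>?ST\<^esub> ?\<iota> b" if a: "a \<in> carrier ?SJ" and b: "b \<in> carrier ?SJ" and wb: "a \<lless>\<^bsub>?SJ\<^esub> b" for a b
  proof -
    obtain f g where f: "f \<in> cu_paths S TJ" "a = path_class S T f"
      and g: "g \<in> cu_paths S TJ" "b = path_class S T g"
      using a b by (auto simp: hom_ideal_carrier_iff)
    obtain m where m: "m \<in> I_Q" "\<And>l. l \<in> I_Q \<Longrightarrow> precedes S TJ (f l) (g m)"
      using wb J.hom_way_below_iff[OF f(1) g(1)] f g by (auto simp: path_class_ideal)
    have "precedes S T (f l) (g m)" if "l \<in> I_Q" for l
      using m that f(1) g(1) by (simp add: cu_paths_ideal_iff precedes_ideal_iff)
    then show ?thesis
      using m(1) hom_way_below_iff[of f g] f g a b by (auto simp: \<iota> cu_paths_ideal_iff)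
  qed
  fix c s assume c: "increasing ?SJ c" and s: "is_sup ?SJ c s"
  obtain F where F: "\<And>n. F n \<in> cu_paths S TJ" "\<And>n. c n = path_class S TJ (F n)"
    "\<And>n. path_lesssim S TJ (F n) (F (Suc n))"
    using J.hom_increasingE[OF c] by blast
  have sc: "s \<in> carrier ?SJ" using s by (simp add: is_sup_def)
  then obtain h where h: "h \<in> cu_paths S TJ" "s = path_class S TJ h" by (rule J.hom_carrierE)
  have ceq: "c = (\<lambda>n. path_class S TJ (F n))" using F(2) by blast
  have "J.path_limit F h" using s J.hom_is_sup_iff[of F h] F(1,3) h by (simp add: ceq)
  then have "path_limit F h"
    using F(1) h(1) unfolding path_limit_def J.path_limit_def
    by (simp add: path_lesssim_ideal_iff) (simp add: cu_paths_ideal_iff precedes_ideal_iff)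
  then have "is_sup ?ST (\<lambda>n. path_class S T (F n)) (path_class S T h)"
    using F(1) h(1) by (intro path_limit_is_sup) (simp_all add: cu_paths_ideal_iff)
  moreover have "\<And>n. c n \<in> carrier ?SJ" using c by (simp add: increasing_def)
  then have "(\<lambda>n. ?\<iota> (c n)) = (\<lambda>n. path_class S T (F n))"
    using F(1,2) by (simp add: \<iota> path_class_ideal)
  moreover have "?\<iota> s = path_class S T h" using sc h by (simp add: \<iota> path_class_ideal)
  ultimately show "is_sup ?ST (\<lambda>n. ?\<iota> (c n)) (?\<iota> s)" by simp
qed

end

theorem proposition4p2:
  fixes S :: "('a, 'm) ordered_monoid_scheme"
    and T :: "('b, 'n) ordered_monoid_scheme"
    and J :: "'b set"
  assumes "cu_semigroup S" and "cu_semigroup T" and "cu_ideal J T"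
  defines "SJ \<equiv> internal_hom S (T\<lparr>carrier := J\<rparr>)"
    and "ST \<equiv> internal_hom S T"
    and "\<iota>_star \<equiv> internal_hom_map S (T\<lparr>carrier := J\<rparr>) T (\<lambda>y \<in> J. y)"
  shows "cu_morphism SJ ST \<iota>_star
    \<and> order_embedding SJ ST \<iota>_star
    \<and> cu_ideal (\<iota>_star ` carrier SJ) ST
    \<and> (\<forall>x \<in> carrier ST.
         (x \<in> \<iota>_star ` carrier SJ \<longleftrightarrow>
            (\<exists>f \<in> cu_paths S T. path_class S T f = x \<and> (\<forall>l \<in> I_Q. f l ` carrier S \<subseteq> J)))
       \<and> (x \<in> \<iota>_star ` carrier SJ \<longleftrightarrow>
            (\<forall>f \<in> cu_paths S T. path_class S T f = x \<longrightarrow> (\<forall>l \<in> I_Q. f l ` carrier S \<subseteq> J))))"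
proof -
  interpret cu_ideal_pair S J T
    by (rule cu_ideal_pair.intro[OF assms(1,3)])
  interpret cu_pair S T by (rule cu_pair.intro[OF assms(1,2)])
  have ex: "x \<in> carrier SJ \<longleftrightarrow>
      (\<exists>f \<in> cu_paths S T. path_class S T f = x \<and> (\<forall>l \<in> I_Q. f l ` carrier S \<subseteq> J))" for x
    unfolding SJ_def by (auto simp: hom_ideal_carrier_iff cu_paths_ideal_iff)
  have all: "x \<in> carrier SJ \<longleftrightarrow>
      (\<forall>f \<in> cu_paths S T. path_class S T f = x \<longrightarrow> (\<forall>l \<in> I_Q. f l ` carrier S \<subseteq> J))"
    if "x \<in> carrier ST" for x
  proof -
    \<comment> \<open>The representative \<open>g\<close> keeps the universal condition from holding
      vacuously; applied to \<open>g\<close>, it already yields membership of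
      \<open>x\<close>.\<close>
    obtain g where g: "g \<in> cu_paths S T" "x = path_class S T g"
      using \<open>x \<in> carrier ST\<close> unfolding ST_def by (rule hom_carrierE)
    have "path_class S T f \<in> carrier SJ \<longleftrightarrow> (\<forall>l \<in> I_Q. f l ` carrier S \<subseteq> J)"
      if "f \<in> cu_paths S T" for f
      using path_class_in_hom_ideal_iff[OF that] that
      by (simp add: SJ_def cu_paths_ideal_iff)
    then show ?thesis using g by (metis (no_types, lifting))
  qed
  have image: "\<iota>_star ` carrier SJ = carrier SJ"
    unfolding \<iota>_star_def SJ_def by (rule internal_hom_map_inclusion_image)
  show ?thesis
    unfolding image
  proof (intro conjI ballI ex all)
    show "cu_morphism SJ ST \<iota>_star"
      unfolding SJ_def ST_def \<iota>_star_def by (rule internal_hom_map_inclusion_cu_morphism)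
    show "order_embedding SJ ST \<iota>_star"
      unfolding SJ_def ST_def \<iota>_star_def by (rule internal_hom_map_inclusion_embedding)
    show "cu_ideal (carrier SJ) ST"
      unfolding SJ_def ST_def by (rule hom_cu_ideal)
  qed
qed

end
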